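(* Let $n\ge 1$ be an integer, let $\delta,\theta\in\mathbb{N}=\{0,1,2,\dots\}$ and $\alpha\in\mathbb{N}\setminus\{0\}$. Consider the Cauchy problem $$u_{tt}+(-\Delta)^\delta u_{tt}+(-\Delta)^\alpha u+(-\Delta)^\theta u_t=|u_t|^p,\quad t\ge 0,\ x\in\mathbb{R}^n,\qquad (u,u_t)(0,x)=(u_0,u_1)(x),$$ with $u_0=0$ and with $u_1,\ (-\Delta)^\delta u_1\in L^1_{loc}(\mathbb{R}^n)$. (a) Suppose that for some $\varepsilon\in(0,1)$ and some $m\in(1,2]$, $$u_1(x)+(-\Delta)^\delta u_1(x)\ \ge\ \varepsilon\,(1+|x|)^{-\frac{n}{m}}\,(\log\langle x\rangle)^{-1}\qquad\text{for a.e. }x\in\mathbb{R}^n.$$ Then there exists no global (in time) weak solution to the Cauchy problem for any $$p\in\left(1,\ 1+\frac{\min\{2\theta,\alpha\}}{n}\,m\right).$$ (b) Suppose instead that the integral $\int_{\mathbb{R}^n}(I+(-\Delta)^\delta)u_1(x)\,dx$ exists and is strictly positive. Then the same conclusion holds with $m=1$, i.e. there exists no global (in time) weak solution to the Cauchy problem for any $p\in\left(1,\ 1+\frac{\min\{2\theta,\alpha\}}{n}\right)$.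
   Context: Notation: $\langle x\rangle=(1+|x|^2)^{1/2}$; $I$ is the identity; $(-\Delta)^k$ for integer $k\ge 0$ is the $k$-th power of $-\Delta=-\sum_{i=1}^n\partial_{x_i}^2$ (with $(-\Delta)^0=I$), taken in the distributional sense. Global weak solution (for data $u_0=0$ and $u_1$): a function $u\in L^1_{loc}([0,\infty)\times\mathbb{R}^n)$ whose distributional time derivative satisfies $u_t\in L^p_{loc}([0,\infty)\times\mathbb{R}^n)$, with $u(0,\cdot)=0$ in the sense that $\int_0^\infty\int_{\mathbb{R}^n}u\,\partial_t\phi\,dx\,dt=-\int_0^\infty\int_{\mathbb{R}^n}u_t\,\phi\,dx\,dt$ for all $\phi\in C_c^\infty([0,\infty)\times\mathbb{R}^n)$, and such that for all $\phi\in C_c^\infty([0,\infty)\times\mathbb{R}^n)$ $$\int_0^\infty\!\!\int_{\mathbb{R}^n}|u_t|^p\phi\,dx\,dt=\int_0^\infty\!\!\int_{\mathbb{R}^n}\Big[u_t\big(-\partial_t\phi-(-\Delta)^\delta\partial_t\phi+(-\Delta)^\theta\phi\big)+u\,(-\Delta)^\alpha\phi\Big]dx\,dt-\int_{\mathbb{R}^n}\big(u_1+(-\Delta)^\delta u_1\big)(x)\,\phi(0,x)\,dx.$$ *)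

theory Defs
  imports "HOL-Analysis.Analysis"
begin

section \<open>Smooth functions and powers of the Laplacian\<close>

definition partial_deriv :: "'a::euclidean_space \<Rightarrow> ('a \<Rightarrow> real) \<Rightarrow> 'a \<Rightarrow> real" where
  "partial_deriv b f x = frechet_derivative f (at x) b"

text \<open>The class of \<open>k\<close> times continuously differentiable functions on the whole space.\<close>

primrec Ck :: "nat \<Rightarrow> ('a::euclidean_space \<Rightarrow> real) \<Rightarrow> bool" where
  "Ck 0 f \<longleftrightarrow> continuous_on UNIV f"
| "Ck (Suc k) f \<longleftrightarrow> f differentiable_on UNIV \<and> (\<forall>b\<in>Basis. Ck k (partial_deriv b f))"

definition smooth :: "('a::euclidean_space \<Rightarrow> real) \<Rightarrow> bool" where
  "smooth f \<longleftrightarrow> (\<forall>k. Ck k f)"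

definition laplacian :: "('a::euclidean_space \<Rightarrow> real) \<Rightarrow> 'a \<Rightarrow> real" where
  "laplacian f x = (\<Sum>b\<in>Basis. partial_deriv b (partial_deriv b f) x)"

definition neg_laplacian_pow :: "nat \<Rightarrow> ('a::euclidean_space \<Rightarrow> real) \<Rightarrow> 'a \<Rightarrow> real" where
  "neg_laplacian_pow k = (\<lambda>f x. - laplacian f x) ^^ k"

text \<open>Operators on functions of \<open>(t, x)\<close>: the time derivative, and powers of the Laplacian
  with respect to the space variable only.\<close>

definition time_deriv :: "(real \<times> 'a::euclidean_space \<Rightarrow> real) \<Rightarrow> real \<times> 'a \<Rightarrow> real" where
  "time_deriv \<phi> = (\<lambda>(t, x). deriv (\<lambda>s. \<phi> (s, x)) t)"

definition space_neg_laplacian_pow ::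
  "nat \<Rightarrow> (real \<times> 'a::euclidean_space \<Rightarrow> real) \<Rightarrow> real \<times> 'a \<Rightarrow> real" where
  "space_neg_laplacian_pow k \<phi> = (\<lambda>(t, x). neg_laplacian_pow k (\<lambda>y. \<phi> (t, y)) x)"


section \<open>Test functions and local integrability\<close>

text \<open>For open \<open>S\<close>, this is \<open>C\<^sub>c\<^sup>\<infinity>(S)\<close>, each function being extended by zero.
  The functions in \<open>C\<^sub>c\<^sup>\<infinity>([0,\<infinity>) \<times> \<real>\<^sup>n)\<close> are the restrictions to \<open>t \<ge> 0\<close> of those in
  \<open>C\<^sub>c\<^sup>\<infinity>(\<real> \<times> \<real>\<^sup>n)\<close>; they need not vanish at \<open>t = 0\<close>. Below they are represented by elements of
  \<open>test_functions UNIV\<close>, of which only the values at \<open>t \<ge> 0\<close> enter.\<close>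

definition test_functions :: "'a::euclidean_space set \<Rightarrow> ('a \<Rightarrow> real) set" where
  "test_functions S =
    {\<phi>. smooth \<phi> \<and> compact (closure {x. \<phi> x \<noteq> 0}) \<and> closure {x. \<phi> x \<noteq> 0} \<subseteq> S}"

definition Lp_loc :: "real \<Rightarrow> 'a::euclidean_space set \<Rightarrow> ('a \<Rightarrow> real) \<Rightarrow> bool" where
  "Lp_loc p S f \<longleftrightarrow> f \<in> borel_measurable (lebesgue_on S) \<and>
    (\<forall>K. compact K \<and> K \<subseteq> S \<longrightarrow> (\<lambda>x. \<bar>f x\<bar> powr p) absolutely_integrable_on K)"

definition L1_loc :: "'a::euclidean_space set \<Rightarrow> ('a \<Rightarrow> real) \<Rightarrow> bool" where
  "L1_loc S f \<longleftrightarrow> Lp_loc 1 S f"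

text \<open>The locally integrable function \<open>w\<close> is the distribution \<open>(-\<Delta>)\<^sup>k f\<close>.\<close>

definition has_distr_neg_laplacian_pow ::
  "nat \<Rightarrow> ('a::euclidean_space \<Rightarrow> real) \<Rightarrow> ('a \<Rightarrow> real) \<Rightarrow> bool" where
  "has_distr_neg_laplacian_pow k f w \<longleftrightarrow>
    (\<forall>\<psi>\<in>test_functions UNIV.
      (LINT x|lebesgue. f x * neg_laplacian_pow k \<psi> x) = (LINT x|lebesgue. w x * \<psi> x))"

text \<open>Lebesgue integral in the extended sense: it exists if at most one of the integrals of
  the positive and the negative part is infinite (\<open>ennreal\<close> maps negative reals to 0).\<close>

definition integral_exists :: "('a::euclidean_space \<Rightarrow> real) \<Rightarrow> bool" where
  "integral_exists g \<longleftrightarrow> g \<in> borel_measurable lebesgue \<and>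
    ((\<integral>\<^sup>+x. ennreal (g x) \<partial>lebesgue) < \<infinity> \<or> (\<integral>\<^sup>+x. ennreal (- g x) \<partial>lebesgue) < \<infinity>)"

definition ext_integral :: "('a::euclidean_space \<Rightarrow> real) \<Rightarrow> ereal" where
  "ext_integral g = enn2ereal (\<integral>\<^sup>+x. ennreal (g x) \<partial>lebesgue)
                  - enn2ereal (\<integral>\<^sup>+x. ennreal (- g x) \<partial>lebesgue)"


section \<open>Weak solutions\<close>

abbreviation half_space_time :: "(real \<times> 'a::euclidean_space) set" where
  "half_space_time \<equiv> {0..} \<times> UNIV"

definition has_distr_time_deriv ::
  "(real \<times> 'a::euclidean_space \<Rightarrow> real) \<Rightarrow> (real \<times> 'a \<Rightarrow> real) \<Rightarrow> bool" where
  "has_distr_time_deriv u v \<longleftrightarrow>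
    (\<forall>\<phi>\<in>test_functions ({0<..} \<times> UNIV).
      (LINT z:half_space_time|lebesgue. u z * time_deriv \<phi> z)
        = - (LINT z:half_space_time|lebesgue. v z * \<phi> z))"

text \<open>Here \<open>\<phi>\<close> may be nonzero at \<open>t = 0\<close>, which encodes \<open>u(0, \<cdot>) = 0\<close>.\<close>

definition vanishes_initially ::
  "(real \<times> 'a::euclidean_space \<Rightarrow> real) \<Rightarrow> (real \<times> 'a \<Rightarrow> real) \<Rightarrow> bool" where
  "vanishes_initially u v \<longleftrightarrow>
    (\<forall>\<phi>\<in>test_functions UNIV.
      (LINT z:half_space_time|lebesgue. u z * time_deriv \<phi> z)
        = - (LINT z:half_space_time|lebesgue. v z * \<phi> z))"

text \<open>Data \<open>u\<^sub>0 = 0\<close> and \<open>u\<^sub>1\<close>; the argument \<open>w\<close> stands for \<open>(-\<Delta>)\<^sup>\<delta> u\<^sub>1\<close>, and \<open>v\<close> is the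
  distributional time derivative \<open>u\<^sub>t\<close>.\<close>

definition global_weak_solution ::
  "nat \<Rightarrow> nat \<Rightarrow> nat \<Rightarrow> real \<Rightarrow> ('a::euclidean_space \<Rightarrow> real) \<Rightarrow> ('a \<Rightarrow> real)
    \<Rightarrow> (real \<times> 'a \<Rightarrow> real) \<Rightarrow> bool" where
  "global_weak_solution \<delta> \<theta> \<alpha> p u1 w u \<longleftrightarrow>
    L1_loc half_space_time u \<and>
    (\<exists>v. Lp_loc p half_space_time v \<and> has_distr_time_deriv u v \<and> vanishes_initially u v \<and>
      (\<forall>\<phi>\<in>test_functions UNIV.
        (LINT z:half_space_time|lebesgue. \<bar>v z\<bar> powr p * \<phi> z) =
        (LINT z:half_space_time|lebesgue.
            v z * (- time_deriv \<phi> z - space_neg_laplacian_pow \<delta> (time_deriv \<phi>) z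
                   + space_neg_laplacian_pow \<theta> \<phi> z)
            + u z * space_neg_laplacian_pow \<alpha> \<phi> z)
        - (LINT x|lebesgue. (u1 x + w x) * \<phi> (0, x))))"

end

theory Submission
  imports Defs "HOL-Real_Asymp.Real_Asymp"
begin

text \<open>Test the weak formulation with \<open>\<phi>(t, x) = - B'(t / T) \<chi>(x / R)\<close>, where
  \<open>\<chi>(x) = exp (- 1 / (1 - |x|\<^sup>2))\<close> on the unit ball and \<open>B\<close> is its one-dimensional analogue
  centred at \<open>- 1 / 2\<close>, so that \<open>- B' \<ge> 0\<close> for \<open>t \<ge> 0\<close> and \<open>- B'(0) > 0\<close>. Since
  \<open>(-\<Delta>)\<^sup>\<alpha> \<phi>\<close> is the time derivative of a test function, the condition \<open>u(0, \<cdot>) = 0\<close> turns the term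
  in \<open>u\<close> into one in \<open>v = u\<^sub>t\<close>. Every factor of \<open>v\<close> is at most
  \<open>M (1 / T + R\<^sup>-\<^sup>2\<^sup>\<theta> + T R\<^sup>-\<^sup>2\<^sup>\<alpha>) \<phi> powr (1 / p)\<close>, because all derivatives of \<open>exp (- 1 / s)\<close> are bounded by
  multiples of \<open>exp (- r / s)\<close> for each \<open>r < 1\<close>. Young's inequality absorbs \<open>v\<close> into
  \<open>|v| powr p \<phi>\<close>, and \<open>T = R powr \<kappa>\<close> with \<open>\<kappa> = min (2\<theta>) \<alpha>\<close> leaves
  \<open>\<integral> (u\<^sub>1 + (-\<Delta>)\<^sup>\<delta> u\<^sub>1) \<chi>(x / R) dx \<le> C R powr (n - \<kappa> / (p - 1))\<close>.
  Either assumption on the data contradicts this as \<open>R\<close> tends to infinity.\<close>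

section \<open>A class of bump functions closed under differentiation\<close>

text \<open>The classical flat function \<open>exp (- 1 / s)\<close> with an extra pole of order
  \<open>k\<close>, cut off at \<open>s = 0\<close>. The pole index is kept as a parameter because
  differentiation only shifts it.\<close>

definition expinv :: "nat \<Rightarrow> real \<Rightarrow> real" where
  "expinv k s = (if s > 0 then exp (- 1 / s) / s ^ k else 0)"

text \<open>Away from 0 this is ordinary calculus. At 0 the exponential beats the factor
  \<open>h ^ (k + 1)\<close> in the denominator of the difference quotient, so the derivative is 0,
  which is also what the right-hand side gives there.\<close>

lemma expinv_has_real_derivative:
  "(expinv k has_real_derivative (expinv (k + 2) s - real k * expinv (k + 1) s)) (at s)"
proof (cases s "0::real" rule: linorder_cases)
  case less
  have "((\<lambda>_. 0) has_real_derivative 0) (at s)" by simp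
  moreover have "eventually (\<lambda>x. (0::real) = expinv k x) (nhds s)"
    using eventually_nhds_in_open[of "{..<0}" s] less
    by (auto simp: expinv_def elim!: eventually_mono)
  ultimately have "(expinv k has_real_derivative 0) (at s)"
    by (rule DERIV_cong_ev[THEN iffD1, OF refl _ refl, rotated])
  then show ?thesis using less by (simp add: expinv_def)
next
  case equal
  have "((\<lambda>h. expinv k h / h) \<longlongrightarrow> 0) (at 0)"
  proof (rule filterlim_split_at)
    have "eventually (\<lambda>h. expinv k h / h = 0) (at_left (0::real))"
      by (auto simp: expinv_def eventually_at_left_field intro: exI[of _ "-1"])
    then show "((\<lambda>h. expinv k h / h) \<longlongrightarrow> 0) (at_left 0)"
      by (simp add: tendsto_eventually)
    have "((\<lambda>h::real. exp (- 1 / h) / h ^ k / h) \<longlongrightarrow> 0) (at_right 0)"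
      by real_asymp
    then show "((\<lambda>h. expinv k h / h) \<longlongrightarrow> 0) (at_right 0)"
      by (rule Lim_transform_eventually)
         (auto simp: expinv_def eventually_at_right_field intro: exI[of _ "1"])
  qed
  then show ?thesis using equal
    by (simp add: DERIV_def expinv_def)
next
  case greater
  have "((\<lambda>x. exp (- 1 / x) / x ^ k) has_real_derivative
      (expinv (k + 2) s - real k * expinv (k + 1) s)) (at s)"
    using greater
    apply (auto intro!: derivative_eq_intros simp: expinv_def)
    \<comment> \<open>The rule for \<open>x ^ k\<close> produces the truncated exponent
      \<open>k - 1\<close>, hence the split.\<close>
    apply (cases k)
    apply (auto simp: field_simps power2_eq_square)
    done
  moreover have "eventually (\<lambda>x. exp (- 1 / x) / x ^ k = expinv k x) (nhds s)"
    using eventually_nhds_in_open[of "{0<..}" s] greater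
    by (auto simp: expinv_def elim!: eventually_mono)
  ultimately show ?thesis
    by (rule DERIV_cong_ev[THEN iffD1, OF refl _ refl, rotated])
qed

text \<open>Used to bring terms with poles of different orders to a common order; the surplus powers
  go into the polynomial factor.\<close>

lemma expinv_mult_power: "s ^ j * expinv (k + j) s = expinv k s"
  by (simp add: expinv_def power_add)

lemma expinv_nonneg: "0 \<le> expinv k s"
  by (simp add: expinv_def)

text \<open>With \<open>y = 1 / s\<close> the quotient of the two sides is
  \<open>y ^ k * exp (- (1 - r) * y)\<close>. It is continuous on \<open>y \<ge> 0\<close> and tends
  to 0 at infinity, hence bounded: the share \<open>1 - r\<close> of the exponential pays for the
  pole.\<close>

lemma expinv_le_powr:
  assumes "r < 1"
  shows "\<exists>C\<ge>0. \<forall>s. expinv k s \<le> C * expinv 0 s powr r"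
proof -
  define f where "f = (\<lambda>y::real. y ^ k * exp (- (1 - r) * y))"
  have "(f \<longlongrightarrow> 0) at_top"
    unfolding f_def using assms by real_asymp
  then have "eventually (\<lambda>y. f y < 1) at_top"
    by (rule order_tendstoD) simp
  then obtain Y where Y: "\<And>y. y \<ge> Y \<Longrightarrow> f y < 1"
    by (auto simp: eventually_at_top_linorder)
  have "bounded (f ` {0..Y})"
    by (intro compact_imp_bounded compact_continuous_image) (auto simp: f_def intro!: continuous_intros)
  then obtain M where "\<forall>y\<in>{0..Y}. \<bar>f y\<bar> \<le> M"
    by (auto simp: bounded_real simp del: atLeastAtMost_iff)
  then have M: "f y \<le> M" if "0 \<le> y" "y \<le> Y" for y
    using that by (meson abs_le_D1 atLeastAtMost_iff)
  show ?thesis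
  proof (intro exI[of _ "max 1 M"] conjI allI)
    fix s
    show "expinv k s \<le> max 1 M * expinv 0 s powr r"
    proof (cases "s > 0")
      case True
      have "f (1/s) \<le> max 1 M"
        using Y[of "1/s"] M[of "1/s"] True by (cases "1/s \<ge> Y") auto
      moreover have "expinv k s = f (1/s) * exp (- r / s)"
        using True by (auto simp: expinv_def f_def field_simps simp flip: exp_add)
      moreover have "expinv 0 s powr r = exp (- r / s)"
        using True by (simp add: expinv_def powr_def field_simps)
      ultimately show ?thesis by (simp add: mult_right_mono)
    qed (auto simp: expinv_def)
  qed auto
qed

text \<open>Induction on the construction of polynomials. The derivative has to be polynomial in the
  base point for each fixed direction, since it becomes the new polynomial factor when a bump
  function is differentiated.\<close>

lemma real_polynomial_function_has_derivative:
  fixes q :: "'a::euclidean_space \<Rightarrow> real"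
  assumes "real_polynomial_function q"
  shows "\<exists>q'. (\<forall>x. (q has_derivative q' x) (at x)) \<and> (\<forall>b. real_polynomial_function (\<lambda>x. q' x b))"
  using assms
proof induction
  case (linear f)
  then show ?case
    by (intro exI[of _ "\<lambda>_. f"]) (auto intro: bounded_linear_imp_has_derivative)
next
  case (const c)
  then show ?case by (intro exI[of _ "\<lambda>_ _. 0"]) auto
next
  case (add f g)
  then obtain f' g' where
    "\<forall>x. (f has_derivative f' x) (at x)" "\<forall>b. real_polynomial_function (\<lambda>x. f' x b)"
    "\<forall>x. (g has_derivative g' x) (at x)" "\<forall>b. real_polynomial_function (\<lambda>x. g' x b)" by blast
  then show ?case
    by (intro exI[of _ "\<lambda>x b. f' x b + g' x b"]) (auto intro!: derivative_intros)
next
  case (mult f g)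
  then obtain f' g' where
    "\<forall>x. (f has_derivative f' x) (at x)" "\<forall>b. real_polynomial_function (\<lambda>x. f' x b)"
    "\<forall>x. (g has_derivative g' x) (at x)" "\<forall>b. real_polynomial_function (\<lambda>x. g' x b)" by blast
  with mult.hyps show ?case
    by (intro exI[of _ "\<lambda>x b. f x * g' x b + f' x b * g x"])
       (auto intro!: has_derivative_mult real_polynomial_function.intros(3,4))
qed

text \<open>Each derivative only changes the polynomial \<open>q\<close> and raises the order \<open>k\<close> of the pole in the
  exponentially small factor, so no sums of such terms are needed.\<close>

definition bumps :: "('a::euclidean_space \<Rightarrow> real) set" where
  "bumps = {\<lambda>x. q x * expinv k (1 - (norm x)\<^sup>2) | q k. real_polynomial_function q}"

lemma bumpsI:
  "real_polynomial_function q \<Longrightarrow> (\<And>x. f x = q x * expinv k (1 - (norm x)\<^sup>2)) \<Longrightarrow> f \<in> bumps"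
  unfolding bumps_def by blast

lemma real_polynomial_function_norm_square:
  "real_polynomial_function (\<lambda>x::'a::euclidean_space. 1 - (norm x)\<^sup>2)"
proof -
  have "(\<lambda>x::'a. 1 - (norm x)\<^sup>2) = (\<lambda>x. 1 - (\<Sum>b\<in>Basis. (x \<bullet> b)^2))"
    by (intro ext) (simp add: power2_norm_eq_inner euclidean_inner[of x x for x :: 'a] power2_eq_square[of "_ \<bullet> _"])
  moreover have "real_polynomial_function \<dots>"
    by (intro real_polynomial_function_diff real_polynomial_function_sum real_polynomial_function_power
        real_polynomial_function.intros bounded_linear_inner_left) auto
  ultimately show ?thesis by simp
qed

text \<open>The chain rule with \<open>s x = 1 - |x|^2\<close> yields terms with poles of order
  \<open>k\<close>, \<open>k + 1\<close> and \<open>k + 2\<close>. Multiplying the first two by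
  \<open>s^2\<close> and \<open>s\<close> puts everything over the pole of order
  \<open>k + 2\<close>, and \<open>s\<close> is itself a polynomial.\<close>

lemma bumps_has_derivative:
  fixes f :: "'a::euclidean_space \<Rightarrow> real"
  assumes "f \<in> bumps"
  shows "\<exists>f'. (\<forall>x. (f has_derivative f' x) (at x)) \<and> (\<forall>b. (\<lambda>x. f' x b) \<in> bumps)"
proof -
  obtain q k where q: "real_polynomial_function q"
    and f: "f = (\<lambda>x. q x * expinv k (1 - (norm x)\<^sup>2))"
    using assms by (auto simp: bumps_def)
  obtain q' where q': "\<And>x. (q has_derivative q' x) (at x)" "\<And>b. real_polynomial_function (\<lambda>x. q' x b)"
    using real_polynomial_function_has_derivative[OF q] by blast
  define s where "s = (\<lambda>x::'a. 1 - (norm x)\<^sup>2)"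
  have s: "(s has_derivative (\<lambda>b. - 2 * (x \<bullet> b))) (at x)" for x
    unfolding s_def power2_norm_eq_inner
    by (auto intro!: derivative_eq_intros simp: inner_commute)
  define f' where "f' = (\<lambda>x b. q x * ((- 2 * (x \<bullet> b)) * (expinv (k + 2) (s x) - real k * expinv (k + 1) (s x)))
      + q' x b * expinv k (s x))"
  have e: "((\<lambda>x. expinv k (s x)) has_derivative
      (\<lambda>b. (- 2 * (x \<bullet> b)) * (expinv (k + 2) (s x) - real k * expinv (k + 1) (s x)))) (at x)" for x
    using has_derivative_compose[OF s[of x], of "expinv k",
      OF expinv_has_real_derivative[unfolded has_field_derivative_def]]
    by (simp add: mult.commute)
  have "\<forall>x. (f has_derivative f' x) (at x)"
    using has_derivative_mult[OF q'(1) e] by (simp add: f f'_def s_def)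
  moreover have "(\<lambda>x. f' x b) \<in> bumps" for b
  proof (rule bumpsI)
    show "real_polynomial_function (\<lambda>x. q x * ((- 2 * (x \<bullet> b)) * (1 - real k * s x)) + q' x b * (s x)^2)"
      unfolding s_def
      by (intro real_polynomial_function_diff real_polynomial_function_power q q'
        real_polynomial_function.intros bounded_linear_inner_left real_polynomial_function_norm_square)
    show "f' x b = (q x * ((- 2 * (x \<bullet> b)) * (1 - real k * s x)) + q' x b * (s x)^2)
        * expinv (k + 2) (1 - (norm x)\<^sup>2)" for x
      using expinv_mult_power[of "s x" 2 k] expinv_mult_power[of "s x" 1 "k+1"]
      unfolding f'_def unfolding s_def[symmetric]
      by (simp add: s_def[symmetric, THEN fun_cong] algebra_simps)
  qed
  ultimately show ?thesis by blast
qed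

section \<open>Closure properties and size of bump functions\<close>

lemma bumps_differentiable: "f \<in> bumps \<Longrightarrow> f differentiable (at x)"
  using bumps_has_derivative differentiable_def by blast

lemma partial_deriv_bumps:
  assumes "f \<in> bumps" shows "partial_deriv b f \<in> bumps"
proof -
  obtain f' where f': "\<And>x. (f has_derivative f' x) (at x)" "(\<lambda>x. f' x b) \<in> bumps"
    using bumps_has_derivative[OF assms] by blast
  then have "partial_deriv b f = (\<lambda>x. f' x b)"
    by (intro ext) (simp add: partial_deriv_def frechet_derivative_at[OF f'(1), symmetric])
  with f' show ?thesis by simp
qed

lemma bumps_scale:
  assumes "f \<in> bumps" shows "(\<lambda>x. c * f x) \<in> bumps"
proof -
  obtain q k where "real_polynomial_function q" "f = (\<lambda>x. q x * expinv k (1 - (norm x)\<^sup>2))"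
    using assms by (auto simp: bumps_def)
  then show ?thesis
    by (intro bumpsI[of "\<lambda>x. c * q x" _ k]) auto
qed

text \<open>Poles of orders \<open>k\<close> and \<open>l\<close> have the common order
  \<open>k + l\<close>; the missing powers of \<open>1 - |x|^2\<close> are absorbed by the
  polynomials.\<close>

lemma bumps_add:
  assumes "f \<in> bumps" "g \<in> bumps" shows "(\<lambda>x. f x + g x) \<in> bumps"
proof -
  obtain q k q' l where *: "real_polynomial_function q" "real_polynomial_function q'"
    and fg: "f = (\<lambda>x. q x * expinv k (1 - (norm x)\<^sup>2))" "g = (\<lambda>x. q' x * expinv l (1 - (norm x)\<^sup>2))"
    using assms by (auto simp: bumps_def)
  show ?thesis
  proof (rule bumpsI)
    show "real_polynomial_function (\<lambda>x. q x * (1 - (norm x)\<^sup>2) ^ l + q' x * (1 - (norm x)\<^sup>2) ^ k)"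
      by (intro real_polynomial_function_power * real_polynomial_function_norm_square
          real_polynomial_function.intros)
    show "f x + g x = (q x * (1 - (norm x)\<^sup>2) ^ l + q' x * (1 - (norm x)\<^sup>2) ^ k)
        * expinv (k + l) (1 - (norm x)\<^sup>2)" for x
      using expinv_mult_power[of "1 - (norm x)\<^sup>2" l k] expinv_mult_power[of "1 - (norm x)\<^sup>2" k l]
      by (simp add: fg distrib_right add.commute[of l k] mult.assoc)
  qed
qed

lemma bumps_sum:
  assumes "finite I" "\<And>i. i \<in> I \<Longrightarrow> f i \<in> bumps" shows "(\<lambda>x. \<Sum>i\<in>I. f i x) \<in> bumps"
  using assms
proof induction
  case empty
  show ?case by (rule bumpsI[of "\<lambda>_. 0" _ 0]) (auto intro: real_polynomial_function.intros)
qed (auto intro: bumps_add)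

lemma neg_laplacian_pow_bumps:
  assumes "f \<in> bumps" shows "neg_laplacian_pow k f \<in> bumps"
proof (induction k)
  case 0
  then show ?case using assms by (simp add: neg_laplacian_pow_def)
next
  case (Suc k)
  have "(\<lambda>x. (-1) * (\<Sum>b\<in>Basis. partial_deriv b (partial_deriv b (neg_laplacian_pow k f)) x)) \<in> bumps"
    using Suc by (intro bumps_scale bumps_sum partial_deriv_bumps) auto
  then show ?case by (simp add: neg_laplacian_pow_def laplacian_def)
qed

lemma bumps_continuous: "f \<in> bumps \<Longrightarrow> continuous_on UNIV f"
  using bumps_differentiable
  by (auto intro!: differentiable_imp_continuous_on simp: differentiable_on_def)

lemma bumps_eq_0: "f \<in> bumps \<Longrightarrow> norm x \<ge> 1 \<Longrightarrow> f x = 0"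
  by (auto simp: bumps_def expinv_def power_less_one_iff not_less) 

text \<open>The polynomial factor is bounded on the closed unit ball, and the function vanishes
  outside it. Later \<open>r = 1 / p\<close>, so that each derivative of a cutoff is controlled by
  the cutoff to the power \<open>1 / p\<close>.\<close>

lemma bumps_le_powr:
  assumes "f \<in> bumps" "r < 1"
  shows "\<exists>C\<ge>0. \<forall>x. \<bar>f x\<bar> \<le> C * expinv 0 (1 - (norm x)\<^sup>2) powr r"
proof -
  obtain q k where q: "real_polynomial_function q"
    and f: "f = (\<lambda>x. q x * expinv k (1 - (norm x)\<^sup>2))"
    using assms by (auto simp: bumps_def)
  have "continuous_on (cball 0 1) q"
    using q by (simp add: continuous_on_polymonial_function real_polynomial_function_eq)
  then have "bounded (q ` cball 0 1)"
    by (intro compact_imp_bounded compact_continuous_image) auto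
  then obtain M where M: "\<And>x. norm x \<le> 1 \<Longrightarrow> \<bar>q x\<bar> \<le> M"
    by (fastforce simp: bounded_real)
  obtain C where C: "C \<ge> 0" "\<And>s. expinv k s \<le> C * expinv 0 s powr r"
    using expinv_le_powr[OF assms(2)] by blast
  have "M \<ge> 0" using M[of 0] by simp
  have "\<bar>f x\<bar> \<le> (M * C) * expinv 0 (1 - (norm x)\<^sup>2) powr r" for x
  proof (cases "norm x \<le> 1")
    case True
    then show ?thesis unfolding f abs_mult mult.assoc
      using M C(2) \<open>M \<ge> 0\<close> by (intro mult_mono) (auto simp: expinv_nonneg)
  next
    case False
    then show ?thesis using bumps_eq_0[OF assms(1), of x] C \<open>M \<ge> 0\<close> by simp
  qed
  then show ?thesis using C \<open>M \<ge> 0\<close> by (intro exI[of _ "M * C"]) auto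
qed

section \<open>Directional derivatives and dilations of bump functions\<close>

lemma bumps_has_derivative_partial:
  "f \<in> bumps \<Longrightarrow> (f has_derivative (\<lambda>b. partial_deriv b f x)) (at x)"
  using bumps_differentiable[of f x] by (simp add: frechet_derivative_works partial_deriv_def)

lemma partial_deriv_scaleR:
  "f \<in> bumps \<Longrightarrow> partial_deriv (c *\<^sub>R b) f x = c * partial_deriv b f x"
  using bumps_has_derivative_partial[THEN has_derivative_linear, of f x] linear_scale by fastforce

lemma partial_deriv_eqI:
  assumes "\<And>x. (f has_derivative f' x) (at x)"
  shows "partial_deriv b f = (\<lambda>x. f' x b)"
  by (intro ext) (simp add: partial_deriv_def frechet_derivative_at[OF assms, symmetric])

lemma partial_deriv_scale:
  assumes "f \<in> bumps"
  shows "partial_deriv b (\<lambda>x. c * f (s *\<^sub>R x)) = (\<lambda>x. c * s * partial_deriv b f (s *\<^sub>R x))"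
proof -
  have "((\<lambda>x. c * f (s *\<^sub>R x)) has_derivative (\<lambda>e. c * partial_deriv (s *\<^sub>R e) f (s *\<^sub>R x))) (at x)" for x
    by (intro has_derivative_mult_right
        has_derivative_compose[OF _ bumps_has_derivative_partial[OF assms]] derivative_intros)
  from partial_deriv_eqI[OF this, of b] show ?thesis
    by (simp add: partial_deriv_scaleR[OF assms] mult.assoc)
qed

text \<open>Every Laplacian contributes two factors \<open>s\<close>. The constant \<open>c\<close>
  will be the time factor of a product test function, frozen while the operator acts in
  space.\<close>

lemma neg_laplacian_pow_scale:
  assumes "f \<in> bumps"
  shows "neg_laplacian_pow k (\<lambda>x. c * f (s *\<^sub>R x))
    = (\<lambda>x. c * (s ^ (2 * k) * neg_laplacian_pow k f (s *\<^sub>R x)))"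
proof (induction k)
  case 0
  then show ?case by (simp add: neg_laplacian_pow_def)
next
  case (Suc k)
  let ?F = "neg_laplacian_pow k f"
  have F: "?F \<in> bumps" using assms by (rule neg_laplacian_pow_bumps)
  have "neg_laplacian_pow (Suc k) (\<lambda>x. c * f (s *\<^sub>R x))
      = (\<lambda>x. - laplacian (neg_laplacian_pow k (\<lambda>x. c * f (s *\<^sub>R x))) x)"
    by (simp add: neg_laplacian_pow_def)
  also have "\<dots> = (\<lambda>x. - laplacian (\<lambda>x. (c * s ^ (2 * k)) * ?F (s *\<^sub>R x)) x)"
    by (simp add: Suc mult.assoc)
  also have "\<dots> = (\<lambda>x. - (\<Sum>b\<in>Basis. (c * s ^ (2 * k) * s * s) * partial_deriv b (partial_deriv b ?F) (s *\<^sub>R x)))"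
    unfolding laplacian_def partial_deriv_scale[OF F]
      partial_deriv_scale[OF partial_deriv_bumps[OF F]] ..
  also have "\<dots> = (\<lambda>x. c * (s ^ (2 * Suc k) * (- laplacian ?F (s *\<^sub>R x))))"
    by (simp add: laplacian_def sum_distrib_left mult_ac flip: sum_negf)
  also have "\<dots> = (\<lambda>x. c * (s ^ (2 * Suc k) * neg_laplacian_pow (Suc k) f (s *\<^sub>R x)))"
    by (simp add: neg_laplacian_pow_def)
  finally show ?case .
qed

section \<open>Product test functions\<close>

text \<open>The induction on the order of differentiability must range over the whole class, because
  the next order concerns the partial derivatives and no longer \<open>f\<close> itself.\<close>

lemma smooth_closedI:
  assumes "f \<in> C"
    and diff: "\<And>f. f \<in> C \<Longrightarrow> f differentiable_on UNIV"
    and partial: "\<And>f b. f \<in> C \<Longrightarrow> b \<in> Basis \<Longrightarrow> partial_deriv b f \<in> C"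
  shows "smooth f"
proof -
  have "Ck k f" if "f \<in> C" for k f
    using that
    by (induction k arbitrary: f) (auto intro: diff partial differentiable_imp_continuous_on)
  with assms(1) show ?thesis by (simp add: smooth_def)
qed

text \<open>For fixed \<open>a\<close>, \<open>d\<close>, \<open>s\<close> every derivative changes
  only the profiles \<open>g\<close> and \<open>h\<close>, so these products are stable under all
  operators in the weak formulation. The shift used below is \<open>d = 1 / 2\<close>.\<close>

definition tensor ::
  "real \<Rightarrow> real \<Rightarrow> real \<Rightarrow> (real \<Rightarrow> real) \<Rightarrow> ('a::euclidean_space \<Rightarrow> real) \<Rightarrow> real \<times> 'a \<Rightarrow> real" where
  "tensor a d s g h = (\<lambda>(t, x). g (a * t + d) * h (s *\<^sub>R x))"

lemma tensor_has_derivative: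
  assumes "g \<in> bumps" "h \<in> bumps"
  shows "(tensor a d s g h has_derivative
    (\<lambda>e. g (a * fst z + d) * partial_deriv (s *\<^sub>R snd e) h (s *\<^sub>R snd z)
       + partial_deriv (a * fst e) g (a * fst z + d) * h (s *\<^sub>R snd z))) (at z)"
  unfolding tensor_def case_prod_beta
  by (intro has_derivative_mult has_derivative_compose[OF _ bumps_has_derivative_partial[OF assms(1)]]
      has_derivative_compose[OF _ bumps_has_derivative_partial[OF assms(2)]])
     (auto intro!: derivative_eq_intros)

text \<open>The stable class consists of all products with the same \<open>a\<close>,
  \<open>d\<close>, \<open>s\<close>: a time derivative adds a factor \<open>a\<close> to the
  derivative of \<open>g\<close>, a space derivative adds a factor \<open>s\<close> to that of
  \<open>h\<close>.\<close>

lemma smooth_tensor: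
  fixes h :: "'a::euclidean_space \<Rightarrow> real"
  assumes "g \<in> bumps" "h \<in> bumps"
  shows "smooth (tensor a d s g h)"
proof (rule smooth_closedI)
  let ?C = "{tensor a d s g h | g (h :: 'a \<Rightarrow> real). g \<in> bumps \<and> h \<in> bumps}"
  show "tensor a d s g h \<in> ?C" using assms by blast
  fix f assume "f \<in> ?C"
  then obtain g h where f: "f = tensor a d s g h" and gh: "g \<in> bumps" "h \<in> bumps" by blast
  note D = tensor_has_derivative[OF gh, of a d s]
  show "f differentiable_on UNIV"
    unfolding f differentiable_on_def differentiable_def using D by blast
  fix b :: "real \<times> 'a" assume "b \<in> Basis"
  then consider "b = (1, 0)" | c where "b = (0, c)"
    by (auto simp: Basis_prod_def)
  then show "partial_deriv b f \<in> ?C"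
  proof cases
    case 1
    have "partial_deriv b f = tensor a d s (\<lambda>t. a * partial_deriv 1 g t) h"
      unfolding f partial_deriv_eqI[OF D] using partial_deriv_scaleR[OF gh(1), of a 1]
        partial_deriv_scaleR[OF gh(2), of 0]
      by (auto simp: 1 tensor_def fun_eq_iff)
    then show ?thesis using gh by (blast intro: bumps_scale partial_deriv_bumps)
  next
    case 2
    have "partial_deriv b f = tensor a d s g (\<lambda>x. s * partial_deriv c h x)"
      unfolding f partial_deriv_eqI[OF D] using partial_deriv_scaleR[OF gh(1), of 0]
        partial_deriv_scaleR[OF gh(2), of s c]
      by (auto simp: 2 tensor_def fun_eq_iff)
    then show ?thesis using gh by (blast intro: bumps_scale partial_deriv_bumps)
  qed
qed

text \<open>The support is enclosed in a box, not in an interval times a ball, so that its volume is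
  an explicit product.\<close>

lemma tensor_eq_0:
  assumes "g \<in> bumps" "h \<in> bumps" "a > 0" "s > 0"
    and "z \<notin> cbox ((-1 - d) / a, - (1 / s) *\<^sub>R One) ((1 - d) / a, (1 / s) *\<^sub>R One)"
  shows "tensor a d s g h z = 0"
proof -
  obtain t x where z: "z = (t, x)" by fastforce
  have "norm (a * t + d) \<ge> 1 \<or> norm (s *\<^sub>R x) \<ge> 1"
  proof (rule ccontr)
    assume "\<not> ?thesis"
    then have 1: "\<bar>a * t + d\<bar> < 1" and 2: "norm (s *\<^sub>R x) < 1" by auto
    have "t \<in> {(-1 - d) / a..(1 - d) / a}"
      using 1 \<open>a > 0\<close> by (auto simp: field_simps abs_less_iff)
    moreover have "x \<in> cbox (- (1 / s) *\<^sub>R One) ((1 / s) *\<^sub>R One)"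
    proof -
      have "\<bar>x \<bullet> b\<bar> \<le> 1 / s" if "b \<in> Basis" for b
      proof -
        have "s * \<bar>x \<bullet> b\<bar> \<le> s * norm x"
          using Basis_le_norm[OF that, of x] \<open>s > 0\<close> by (intro mult_left_mono) auto
        also have "\<dots> \<le> 1" using 2 \<open>s > 0\<close> by simp
        finally show ?thesis using \<open>s > 0\<close> by (simp add: field_simps)
      qed
      then show ?thesis by (force simp: mem_box abs_le_iff)
    qed
    ultimately show False using assms(5) by (auto simp: z cbox_Pair_eq)
  qed
  then show ?thesis
    using bumps_eq_0[OF assms(1)] bumps_eq_0[OF assms(2)] by (auto simp: z tensor_def)
qed

lemma tensor_test_function:
  assumes "g \<in> bumps" "h \<in> bumps" "a > 0" "s > 0"
  shows "tensor a d s g h \<in> test_functions UNIV"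
proof -
  have "bounded {z. tensor a d s g h z \<noteq> 0}"
    by (rule bounded_subset[OF bounded_cbox]) (use tensor_eq_0[OF assms] in blast)
  then show ?thesis
    using smooth_tensor[OF assms(1,2)] by (simp add: test_functions_def compact_closure)
qed

lemma continuous_on_tensor:
  assumes "g \<in> bumps" "h \<in> bumps"
  shows "continuous_on UNIV (tensor a d s g h)"
  using smooth_tensor[OF assms, of a d s] by (auto simp: smooth_def dest: spec[of _ 0])

lemma time_deriv_tensor:
  assumes "g \<in> bumps"
  shows "time_deriv (tensor a d s g h) = tensor a d s (\<lambda>t. a * partial_deriv 1 g t) h"
proof -
  have "deriv (\<lambda>r. tensor a d s g h (r, x)) t = a * partial_deriv 1 g (a * t + d) * h (s *\<^sub>R x)" for t x
  proof (rule DERIV_imp_deriv)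
    \<comment> \<open>This links the Frechet derivative in direction 1, used for
      \<open>bumps\<close>, to the one-variable derivative behind \<open>deriv\<close>.\<close>
    have D: "(g has_real_derivative partial_deriv 1 g y) (at y)" for y
    proof -
      have "(\<lambda>b. partial_deriv b g y) = (*) (partial_deriv 1 g y)"
      proof
        show "partial_deriv b g y = partial_deriv 1 g y * b" for b
          using partial_deriv_scaleR[OF assms, of b 1 y] by simp
      qed
      then show ?thesis
        using bumps_has_derivative_partial[OF assms, of y] by (simp add: has_field_derivative_def)
    qed
    have "((\<lambda>r. g (a * r + d)) has_real_derivative partial_deriv 1 g (a * t + d) * a) (at t)"
      by (rule DERIV_chain2[OF D]) (auto intro!: derivative_eq_intros)
    then show "((\<lambda>r. tensor a d s g h (r, x)) has_real_derivative
        a * partial_deriv 1 g (a * t + d) * h (s *\<^sub>R x)) (at t)"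
      unfolding tensor_def prod.case by (simp add: DERIV_cmult_right mult.commute[of a])
  qed
  then show ?thesis by (simp add: time_deriv_def tensor_def fun_eq_iff)
qed

lemma space_neg_laplacian_pow_tensor:
  assumes "h \<in> bumps"
  shows "space_neg_laplacian_pow k (tensor a d s g h)
    = tensor a d s g (\<lambda>x. s ^ (2 * k) * neg_laplacian_pow k h x)"
  unfolding space_neg_laplacian_pow_def tensor_def prod.case neg_laplacian_pow_scale[OF assms] ..

lemma tensor_scale:
  "tensor a d s (\<lambda>t. c * g t) (\<lambda>x. e * h x) z = c * e * tensor a d s g h z"
  "tensor a d s (\<lambda>t. c * g t) h z = c * tensor a d s g h z"
  "tensor a d s g (\<lambda>x. e * h x) z = e * tensor a d s g h z"
  by (simp_all add: tensor_def case_prod_beta)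

section \<open>Integrability against test functions\<close>

text \<open>Only \<open>K \<inter> S\<close> matters, which is compact because \<open>S\<close> is
  closed; there \<open>f\<close> is integrable and \<open>g\<close> is bounded. For the half space
  this includes the boundary \<open>t = 0\<close>.\<close>

lemma L1_loc_mult_integrable:
  fixes f g :: "'a::euclidean_space \<Rightarrow> real"
  assumes f: "L1_loc S f" and "closed S" and g: "continuous_on UNIV g"
    and K: "compact K" "\<And>x. x \<notin> K \<Longrightarrow> g x = 0"
  shows "set_integrable lebesgue S (\<lambda>x. f x * g x)"
proof -
  have KS: "compact (K \<inter> S)" using K \<open>closed S\<close> by (simp add: compact_Int_closed)
  then have m: "K \<inter> S \<in> sets lebesgue" by (simp add: lmeasurable_compact fmeasurableD)
  have "(\<lambda>x. \<bar>f x\<bar>) absolutely_integrable_on (K \<inter> S)"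
    using f KS by (auto simp: L1_loc_def Lp_loc_def)
  \<comment> \<open>Local integrability is stated for the absolute value, so measurability is needed
    to return to \<open>f\<close>.\<close>
  moreover have "f \<in> borel_measurable (lebesgue_on (K \<inter> S))"
    using f by (auto simp: L1_loc_def Lp_loc_def intro: measurable_restrict_mono)
  ultimately have f': "f absolutely_integrable_on (K \<inter> S)"
    using m by (intro measurable_bounded_by_integrable_imp_absolutely_integrable[of f _ "\<lambda>x. \<bar>f x\<bar>"])
      (auto simp: set_lebesgue_integral_eq_integral)
  have gc: "continuous_on (K \<inter> S) g" using g continuous_on_subset by blast
  have "(\<lambda>x. g x * f x) absolutely_integrable_on (K \<inter> S)"
    using f' m gc KS
    by (intro absolutely_integrable_bounded_measurable_product[OF bilinear_times] continuous_imp_measurable_on_sets_lebesgue)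
       (auto intro: compact_imp_bounded compact_continuous_image)
  moreover have "indicator (K \<inter> S) x *\<^sub>R (g x * f x) = indicator S x *\<^sub>R (f x * g x)" for x
    using K(2) by (auto simp: indicator_def)
  ultimately show ?thesis by (simp only: set_integrable_def)
qed

lemma Lp_loc_powr: "Lp_loc p S f \<Longrightarrow> L1_loc S (\<lambda>x. \<bar>f x\<bar> powr p)"
  by (auto simp: L1_loc_def Lp_loc_def)

text \<open>On a compact set the function \<open>1 + |f| powr p\<close> is an integrable majorant of
  \<open>|f|\<close>.\<close>

lemma Lp_loc_imp_L1_loc:
  fixes f :: "'a::euclidean_space \<Rightarrow> real"
  assumes f: "Lp_loc p S f" and "p \<ge> 1"
  shows "L1_loc S f"
  unfolding L1_loc_def Lp_loc_def
proof (intro conjI allI impI)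
  show m: "f \<in> borel_measurable (lebesgue_on S)" using f by (simp add: Lp_loc_def)
  fix K assume K: "compact K \<and> K \<subseteq> S"
  then have l: "K \<in> lmeasurable" by (simp add: lmeasurable_compact)
  have i: "(\<lambda>x. \<bar>f x\<bar> powr p) absolutely_integrable_on K" using f K by (simp add: Lp_loc_def)
  have m': "f \<in> borel_measurable (lebesgue_on K)" using m K by (auto intro: measurable_restrict_mono)
  show "(\<lambda>x. \<bar>f x\<bar> powr 1) absolutely_integrable_on K"
  proof (rule measurable_bounded_by_integrable_imp_absolutely_integrable)
    show "(\<lambda>x. \<bar>f x\<bar> powr 1) \<in> borel_measurable (lebesgue_on K)" using m' by simp
    show "K \<in> sets lebesgue" using l by (rule fmeasurableD)
    show "(\<lambda>x. 1 + \<bar>f x\<bar> powr p) integrable_on K"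
      using i l by (intro integrable_add integrable_on_const) (auto simp: set_lebesgue_integral_eq_integral)
    fix x
    show "norm (\<bar>f x\<bar> powr 1) \<le> 1 + \<bar>f x\<bar> powr p"
    proof (cases "\<bar>f x\<bar> \<ge> 1")
      case True
      then have "\<bar>f x\<bar> powr 1 \<le> \<bar>f x\<bar> powr p" using \<open>p \<ge> 1\<close> by (intro powr_mono) auto
      then show ?thesis by simp
    next
      case False
      then show ?thesis by (simp add: add_increasing2)
    qed
  qed
qed

section \<open>Consequences of the weak formulation\<close>

definition std_bump :: "'a::euclidean_space \<Rightarrow> real" where
  "std_bump x = expinv 0 (1 - (norm x)\<^sup>2)"

text \<open>Minus the derivative of the one-dimensional \<open>std_bump\<close>, written out so that
  its sign and its membership in \<open>bumps\<close> are visible.\<close>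

definition time_profile :: "real \<Rightarrow> real" where
  "time_profile t = 2 * t * expinv 2 (1 - t\<^sup>2)"

lemma std_bump_bumps: "std_bump \<in> bumps"
  by (rule bumpsI[of "\<lambda>_. 1" _ 0]) (auto simp: std_bump_def)

lemma time_profile_bumps: "time_profile \<in> bumps"
  by (rule bumpsI[of "\<lambda>t. 2 * t" _ 2])
     (auto simp: time_profile_def intro!: real_polynomial_function.intros bounded_linear_mult_right)

lemma std_bump_nonneg: "0 \<le> std_bump x"
  by (simp add: std_bump_def expinv_nonneg)

lemma partial_deriv_std_bump: "partial_deriv 1 std_bump = (\<lambda>t. - time_profile t)"
proof -
  have "(std_bump has_real_derivative - time_profile t) (at t)" for t :: real
  proof -
    have "((\<lambda>t. expinv 0 (1 - t\<^sup>2)) has_real_derivative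
        (expinv (0 + 2) (1 - t\<^sup>2) - real 0 * expinv (0 + 1) (1 - t\<^sup>2)) * (- 2 * t)) (at t)"
      by (rule DERIV_chain2[OF expinv_has_real_derivative]) (auto intro!: derivative_eq_intros)
    then show ?thesis
      by (simp add: std_bump_def[abs_def] time_profile_def numeral_2_eq_2 mult_ac)
  qed
  then show ?thesis
    using partial_deriv_eqI[of std_bump "\<lambda>t. (*) (- time_profile t)" 1]
    by (simp add: has_field_derivative_def)
qed

text \<open>For \<open>1 / 2 \<le> t < 1\<close> one has
  \<open>(1 - t^2)^2 \<le> 1 \<le> 2 * t\<close>. The shift \<open>d = 1 / 2\<close> puts all times
  \<open>t \<ge> 0\<close> into this range, so that bounds by \<open>std_bump\<close> become bounds
  by the time factor of the test function.\<close>

lemma std_bump_le_time_profile: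
  assumes "t \<ge> 1 / 2" shows "std_bump t \<le> time_profile t"
proof -
  have "std_bump t = (1 - t\<^sup>2) ^ 2 * expinv 2 (1 - t\<^sup>2)"
    using expinv_mult_power[of "1 - t\<^sup>2" 2 0] by (simp add: std_bump_def numeral_2_eq_2)
  also have "\<dots> \<le> (2 * t) * expinv 2 (1 - t\<^sup>2)"
  proof (cases "t < 1")
    case True
    then have "(1 - t\<^sup>2) ^ 2 \<le> 1" using assms by (intro power_le_one) (auto simp: power_le_one)
    then show ?thesis using assms by (intro mult_right_mono expinv_nonneg) auto
  next
    case False
    then have "1 \<le> t\<^sup>2" by (simp add: one_le_power)
    then show ?thesis by (simp add: expinv_def)
  qed
  finally show ?thesis by (simp add: time_profile_def)
qed

lemma time_profile_nonneg: "t \<ge> 1 / 2 \<Longrightarrow> 0 \<le> time_profile t"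
  using std_bump_le_time_profile std_bump_nonneg[of t] by fastforce

lemma time_profile_half_pos: "time_profile (1 / 2) > 0"
  by (simp add: time_profile_def expinv_def power2_eq_square)

text \<open>Both factors are estimated in the rescaled variables, so \<open>M\<close> is independent
  of \<open>a\<close> and \<open>s\<close>; all dependence on the scales stays in the explicit
  coefficients.\<close>

lemma tensor_le_powr:
  fixes h :: "'a::euclidean_space \<Rightarrow> real"
  assumes "g \<in> bumps" "h \<in> bumps" "0 \<le> r" "r < 1"
  shows "\<exists>M\<ge>0. \<forall>a s z. 0 < a \<longrightarrow> 0 \<le> fst z \<longrightarrow>
    \<bar>tensor a (1 / 2) s g h z\<bar> \<le> M * tensor a (1 / 2) s time_profile std_bump z powr r"
proof -
  obtain B C where B: "B \<ge> 0" "\<And>t. \<bar>g t\<bar> \<le> B * std_bump t powr r"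
    and C: "C \<ge> 0" "\<And>x. \<bar>h x\<bar> \<le> C * std_bump x powr r"
    using bumps_le_powr[OF assms(1,4)] bumps_le_powr[OF assms(2,4)]
    unfolding std_bump_def by blast
  have "\<bar>tensor a (1 / 2) s g h z\<bar> \<le> (B * C) * tensor a (1 / 2) s time_profile std_bump z powr r"
    if "0 < a" "0 \<le> fst z" for a s z
  proof -
    define \<tau> where "\<tau> = a * fst z + 1 / 2"
    have \<tau>: "\<tau> \<ge> 1 / 2" using that by (simp add: \<tau>_def)
    have "\<bar>g \<tau>\<bar> \<le> B * time_profile \<tau> powr r"
      using B(1) assms(3) std_bump_le_time_profile[OF \<tau>] std_bump_nonneg
      by (intro order_trans[OF B(2)] mult_left_mono powr_mono2) auto
    then have "\<bar>g \<tau>\<bar> * \<bar>h (s *\<^sub>R snd z)\<bar>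
        \<le> (B * time_profile \<tau> powr r) * (C * std_bump (s *\<^sub>R snd z) powr r)"
      using C B by (intro mult_mono) auto
    then show ?thesis
      using time_profile_nonneg[OF \<tau>] std_bump_nonneg
      by (simp add: tensor_def case_prod_beta abs_mult \<tau>_def[symmetric] powr_mult mult_ac)
  qed
  then show ?thesis using B(1) C(1) by (intro exI[of _ "B * C"]) auto
qed

text \<open>Either \<open>b \<le> X powr (p - 1)\<close>, and the first summand suffices, or
  \<open>X\<close> is at most \<open>b powr (1 / (p - 1))\<close>, and the second does. The
  coefficient 1 of \<open>X powr p\<close> permits exact cancellation against the nonlinear
  term.\<close>

lemma young_scaled:
  fixes p :: real
  assumes "p > 1" "X \<ge> 0" "b \<ge> 0"
  shows "b * X \<le> X powr p + b powr (p / (p - 1))"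
proof (cases "b \<le> X powr (p - 1)")
  case True
  then have "b * X \<le> X powr (p - 1) * X" using assms by (intro mult_right_mono) auto
  also have "\<dots> = X powr p" using assms by (cases "X = 0") (auto simp: powr_diff)
  finally show ?thesis by (simp add: add_increasing2)
next
  case False
  then have b: "b > 0" using assms by (meson not_le powr_ge_zero order_le_less_trans)
  have "X = (X powr (p - 1)) powr (1 / (p - 1))"
    using assms by (simp add: powr_powr)
  also have "\<dots> \<le> b powr (1 / (p - 1))" using False assms by (intro powr_mono2) auto
  finally have "b * X \<le> b powr 1 * b powr (1 / (p - 1))" using b by simp
  also have "\<dots> = b powr (p / (p - 1))"
    using assms by (simp only: flip: powr_add) (simp add: field_simps)
  finally show ?thesis by (simp add: add_increasing)
qed

section \<open>From the weak formulation to a bound on the data\<close>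

lemma abs_combination_le:
  fixes c1 c2 c3 c4 :: real
  assumes "\<bar>x1\<bar> \<le> y1" "\<bar>x2\<bar> \<le> y2" "\<bar>x3\<bar> \<le> y3" "\<bar>x4\<bar> \<le> y4"
    and "0 \<le> c1" "0 \<le> c2" "0 \<le> c3" "0 \<le> c4"
  shows "\<bar>- (c1 * x1) - c2 * x2 + c3 * x3 + c4 * x4\<bar> \<le> c1 * y1 + c2 * y2 + c3 * y3 + c4 * y4"
proof -
  have "\<bar>c * x\<bar> \<le> c * y" if "\<bar>x\<bar> \<le> y" "0 \<le> c" for c x y :: real
    using that by (simp add: abs_mult mult_left_mono)
  from this[OF assms(1,5)] this[OF assms(2,6)] this[OF assms(3,7)] this[OF assms(4,8)]
  show ?thesis by linarith
qed

text \<open>Here \<open>a = 1 / T\<close> and \<open>s = 1 / R\<close>.\<close>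

lemma weak_solution_data_bound:
  fixes u1 w :: "'a::euclidean_space \<Rightarrow> real"
  assumes sol: "global_weak_solution \<delta> \<theta> \<alpha> p u1 w u" and "p > 1"
  shows "\<exists>C\<ge>0. \<forall>a s. 0 < a \<longrightarrow> 0 < s \<longrightarrow> s \<le> 1 \<longrightarrow>
    (LINT x|lebesgue. (u1 x + w x) * std_bump (s *\<^sub>R x))
      \<le> C * (a + s ^ (2 * \<theta>) + s ^ (2 * \<alpha>) / a) powr (p / (p - 1)) / (a * s ^ DIM('a))"
proof -
  let ?H = "half_space_time :: (real \<times> 'a) set"
  obtain v where u: "L1_loc ?H u" and v: "Lp_loc p ?H v" and van: "vanishes_initially u v"
    and weak: "\<And>\<phi>. \<phi> \<in> test_functions UNIV \<Longrightarrow>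
        (LINT z:?H|lebesgue. \<bar>v z\<bar> powr p * \<phi> z) =
        (LINT z:?H|lebesgue.
            v z * (- time_deriv \<phi> z - space_neg_laplacian_pow \<delta> (time_deriv \<phi>) z
                   + space_neg_laplacian_pow \<theta> \<phi> z)
            + u z * space_neg_laplacian_pow \<alpha> \<phi> z)
        - (LINT x|lebesgue. (u1 x + w x) * \<phi> (0, x))"
    using sol unfolding global_weak_solution_def by blast
  have v1: "L1_loc ?H v" using Lp_loc_imp_L1_loc[OF v] \<open>p > 1\<close> by simp
  have H: "closed ?H" by (intro closed_Times) auto
  define L :: "nat \<Rightarrow> 'a \<Rightarrow> real" where "L k = neg_laplacian_pow k std_bump" for k
  have L: "L k \<in> bumps" for k
    unfolding L_def by (intro neg_laplacian_pow_bumps std_bump_bumps)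
  define g2 where "g2 = partial_deriv 1 time_profile"
  have g2: "g2 \<in> bumps" unfolding g2_def by (intro partial_deriv_bumps time_profile_bumps)
  \<comment> \<open>Chosen so that
    \<open>(|v| * \<phi> powr r) powr p = |v| powr p * \<phi>\<close>.\<close>
  define r where "r = 1 / p"
  have r: "0 \<le> r" "r < 1" using \<open>p > 1\<close> by (auto simp: r_def)
  note le = tensor_le_powr[OF _ _ r]
  obtain M1 where M1: "M1 \<ge> 0" "\<And>a s z. 0 < a \<Longrightarrow> 0 \<le> fst z \<Longrightarrow>
      \<bar>tensor a (1 / 2) s g2 std_bump z\<bar> \<le> M1 * tensor a (1 / 2) s time_profile (std_bump :: 'a \<Rightarrow> real) z powr r"
    using le[OF g2 std_bump_bumps] by blast
  obtain M2 where M2: "M2 \<ge> 0" "\<And>a s z. 0 < a \<Longrightarrow> 0 \<le> fst z \<Longrightarrow>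
      \<bar>tensor a (1 / 2) s g2 (L \<delta>) z\<bar> \<le> M2 * tensor a (1 / 2) s time_profile (std_bump :: 'a \<Rightarrow> real) z powr r"
    using le[OF g2 L] by blast
  obtain M3 where M3: "M3 \<ge> 0" "\<And>a s z. 0 < a \<Longrightarrow> 0 \<le> fst z \<Longrightarrow>
      \<bar>tensor a (1 / 2) s time_profile (L \<theta>) z\<bar> \<le> M3 * tensor a (1 / 2) s time_profile (std_bump :: 'a \<Rightarrow> real) z powr r"
    using le[OF time_profile_bumps L] by blast
  obtain M4 where M4: "M4 \<ge> 0" "\<And>a s z. 0 < a \<Longrightarrow> 0 \<le> fst z \<Longrightarrow>
      \<bar>tensor a (1 / 2) s std_bump (L \<alpha>) z\<bar> \<le> M4 * tensor a (1 / 2) s time_profile (std_bump :: 'a \<Rightarrow> real) z powr r"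
    using le[OF std_bump_bumps L] by blast
  note M = M1(1) M2(1) M3(1) M4(1) and bd = M1(2) M2(2) M3(2) M4(2)
  define M where "M = M1 + M2 + M3 + M4"
  \<comment> \<open>\<open>M powr (p / (p - 1))\<close> comes from Young's inequality,
    \<open>2 ^ DIM('a)\<close> from the volume of the support box, and the denominator from the
    value of the time factor at \<open>t = 0\<close>.\<close>
  define C where "C = (M powr (p / (p - 1)) * 2 ^ DIM('a)) / time_profile (1 / 2)"
  have C0: "C \<ge> 0"
    using time_profile_half_pos by (simp add: C_def)
  have "(LINT x|lebesgue. (u1 x + w x) * std_bump (s *\<^sub>R x))
      \<le> C * (a + s ^ (2 * \<theta>) + s ^ (2 * \<alpha>) / a) powr (p / (p - 1)) / (a * s ^ DIM('a))"
    if a: "0 < a" and s: "0 < s" "s \<le> 1" for a s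
  proof -
    let ?T = "tensor a (1 / 2) s :: _ \<Rightarrow> ('a \<Rightarrow> real) \<Rightarrow> _"
    define A where "A = a + s ^ (2 * \<theta>) + s ^ (2 * \<alpha>) / a"
    define \<phi> where "\<phi> = ?T time_profile std_bump"
    \<comment> \<open>an antiderivative in time of \<open>(-\<Delta>)\<^sup>\<alpha> \<phi>\<close>\<close>
    define \<psi> where "\<psi> = ?T (\<lambda>t. (- 1 / a) * std_bump t) (\<lambda>x. s ^ (2 * \<alpha>) * L \<alpha> x)"
    \<comment> \<open>The factor of \<open>v\<close> in the weak formulation, with all powers of the
      scales pulled out.\<close>
    define F where "F = (\<lambda>z. - (a * ?T g2 std_bump z) - a * s ^ (2 * \<delta>) * ?T g2 (L \<delta>) z
        + s ^ (2 * \<theta>) * ?T time_profile (L \<theta>) z)"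
    \<comment> \<open>\<open>Q\<close> encloses the supports in all of space-time, \<open>P\<close>
      is its part with \<open>t \<ge> 0\<close>.\<close>
    define Q where "Q = cbox ((-1 - 1 / 2) / a, - (1 / s) *\<^sub>R (One :: 'a)) ((1 - 1 / 2) / a, (1 / s) *\<^sub>R One)"
    define P where "P = cbox (0, - (1 / s) *\<^sub>R (One :: 'a)) (1 / (2 * a), (1 / s) *\<^sub>R One)"
    have Pm: "P \<in> lmeasurable" by (simp add: P_def)
    have PH: "(\<lambda>z. indicator ?H z *\<^sub>R (c * indicator P z)) = (\<lambda>z. c * indicator P z)" for c :: real
      by (auto simp: P_def cbox_Pair_eq indicator_def fun_eq_iff)
    have Q0: "?T g h z = 0" if "g \<in> bumps" "h \<in> bumps" "z \<notin> Q" for g h z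
      using tensor_eq_0[OF that(1,2) a s(1)] that(3) unfolding Q_def by blast
    have cont: "continuous_on UNIV (?T g h)" if "g \<in> bumps" "h \<in> bumps" for g h
      using that by (rule continuous_on_tensor)
    have \<phi>_test: "\<phi> \<in> test_functions UNIV"
      unfolding \<phi>_def by (intro tensor_test_function time_profile_bumps std_bump_bumps a s)
    have \<psi>_test: "\<psi> \<in> test_functions UNIV"
      unfolding \<psi>_def by (intro tensor_test_function bumps_scale L std_bump_bumps a s)
    have t\<phi>: "time_deriv \<phi> = ?T (\<lambda>t. a * g2 t) std_bump"
      unfolding \<phi>_def g2_def by (rule time_deriv_tensor[OF time_profile_bumps])
    have s\<phi>: "space_neg_laplacian_pow k \<phi> = ?T time_profile (\<lambda>x. s ^ (2 * k) * L k x)" for k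
      unfolding \<phi>_def L_def by (rule space_neg_laplacian_pow_tensor[OF std_bump_bumps])
    have ts\<phi>: "space_neg_laplacian_pow k (time_deriv \<phi>) = ?T (\<lambda>t. a * g2 t) (\<lambda>x. s ^ (2 * k) * L k x)" for k
      unfolding t\<phi> L_def by (rule space_neg_laplacian_pow_tensor[OF std_bump_bumps])
    \<comment> \<open>The factor \<open>- 1 / a\<close> in \<open>\<psi>\<close> cancels the
      chain-rule factor \<open>a\<close> and the minus sign in the derivative of
      \<open>std_bump\<close>.\<close>
    have t\<psi>: "time_deriv \<psi> = space_neg_laplacian_pow \<alpha> \<phi>"
    proof -
      have "partial_deriv 1 (\<lambda>t. (- 1 / a) * std_bump t) = (\<lambda>t. (1 / a) * time_profile t)"
        using partial_deriv_scale[OF std_bump_bumps, of "1::real" "- 1 / a" 1]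
        by (simp add: partial_deriv_std_bump)
      then show ?thesis
        using a time_deriv_tensor[OF bumps_scale[OF std_bump_bumps], of a "1/2" s "- 1 / a" "\<lambda>x. s ^ (2 * \<alpha>) * L \<alpha> x"]
        by (simp add: s\<phi> \<psi>_def)
    qed
    have F: "- time_deriv \<phi> z - space_neg_laplacian_pow \<delta> (time_deriv \<phi>) z
        + space_neg_laplacian_pow \<theta> \<phi> z = F z" for z
      unfolding s\<phi> ts\<phi> unfolding t\<phi> tensor_scale F_def by simp
    have Fc: "continuous_on UNIV F"
      unfolding F_def by (intro continuous_intros cont g2 L std_bump_bumps time_profile_bumps)
    have F0: "F z = 0" if "z \<notin> Q" for z
      unfolding F_def using that by (simp add: Q0 g2 L std_bump_bumps time_profile_bumps)
    have \<psi>c: "continuous_on UNIV \<psi>" "\<And>z. z \<notin> Q \<Longrightarrow> \<psi> z = 0"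
      unfolding \<psi>_def by (intro cont Q0 bumps_scale L std_bump_bumps; assumption)+
    have \<phi>c: "continuous_on UNIV \<phi>" "\<And>z. z \<notin> Q \<Longrightarrow> \<phi> z = 0"
      unfolding \<phi>_def by (intro cont Q0 time_profile_bumps std_bump_bumps; assumption)+
    have s\<phi>c: "continuous_on UNIV (space_neg_laplacian_pow \<alpha> \<phi>)"
       "\<And>z. z \<notin> Q \<Longrightarrow> space_neg_laplacian_pow \<alpha> \<phi> z = 0"
      unfolding s\<phi> by (intro cont Q0 time_profile_bumps bumps_scale L; assumption)+
    have Qc: "compact Q" by (simp add: Q_def)
    note int = L1_loc_mult_integrable[OF _ H _ Qc]
    have i1: "set_integrable lebesgue ?H (\<lambda>z. v z * F z)"
      and i2: "set_integrable lebesgue ?H (\<lambda>z. u z * space_neg_laplacian_pow \<alpha> \<phi> z)"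
      and i3: "set_integrable lebesgue ?H (\<lambda>z. v z * \<psi> z)"
      and i4: "set_integrable lebesgue ?H (\<lambda>z. \<bar>v z\<bar> powr p * \<phi> z)"
      using int[OF v1 Fc F0] int[OF u s\<phi>c] int[OF v1 \<psi>c] int[OF Lp_loc_powr[OF v] \<phi>c] by blast+
    let ?D = "LINT x|lebesgue. (u1 x + w x) * std_bump (s *\<^sub>R x)"
    have D: "(LINT x|lebesgue. (u1 x + w x) * \<phi> (0, x)) = time_profile (1 / 2) * ?D"
      by (subst integral_mult_right_zero[symmetric]) (simp add: \<phi>_def tensor_def mult_ac)
    \<comment> \<open>Since \<open>\<psi>\<close> need not vanish at \<open>t = 0\<close>, this is
      where the initial condition on \<open>u\<close> enters.\<close>
    have u\<phi>: "(LINT z:?H|lebesgue. u z * space_neg_laplacian_pow \<alpha> \<phi> z)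
        = - (LINT z:?H|lebesgue. v z * \<psi> z)"
      using van \<psi>_test unfolding vanishes_initially_def t\<psi>[symmetric] by blast
    \<comment> \<open>The weak formulation solved for the data term, with \<open>u\<close>
      eliminated.\<close>
    have "time_profile (1 / 2) * ?D = (LINT z:?H|lebesgue. v z * F z) - (LINT z:?H|lebesgue. v z * \<psi> z)
        - (LINT z:?H|lebesgue. \<bar>v z\<bar> powr p * \<phi> z)"
      using weak[OF \<phi>_test] unfolding F D set_integral_add(2)[OF i1 i2] u\<phi> by simp
    also have "\<dots> = (LINT z:?H|lebesgue. v z * F z - v z * \<psi> z - \<bar>v z\<bar> powr p * \<phi> z)"
      using i1 i3 i4 by (simp add: set_integral_diff)
    also have "\<dots> \<le> (LINT z:?H|lebesgue. (M * A) powr (p / (p - 1)) * indicator P z)"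
    proof (rule set_integral_mono)
      show "set_integrable lebesgue ?H (\<lambda>z. v z * F z - v z * \<psi> z - \<bar>v z\<bar> powr p * \<phi> z)"
        using i1 i3 i4 by (intro set_integral_diff(1))
      show "set_integrable lebesgue ?H (\<lambda>z. (M * A) powr (p / (p - 1)) * indicator P z)"
        unfolding set_integrable_def PH using Pm
        by (intro integrable_mult_right integrable_real_indicator) (auto simp: fmeasurable_def)
      fix z :: "real \<times> 'a" assume z: "z \<in> ?H"
      show "v z * F z - v z * \<psi> z - \<bar>v z\<bar> powr p * \<phi> z \<le> (M * A) powr (p / (p - 1)) * indicator P z"
      proof (cases "z \<in> P")
        case False
        then have "z \<notin> Q"
          using z a by (auto simp: P_def Q_def cbox_Pair_eq mem_Times_iff)
        with False show ?thesis by (simp add: F0 \<psi>c \<phi>c)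
      next
        case True
        have z0: "0 \<le> fst z" using z by auto
        then have \<phi>0: "0 \<le> \<phi> z"
          using a time_profile_nonneg[of "a * fst z + 1 / 2"]
          by (auto simp: \<phi>_def tensor_def case_prod_beta std_bump_nonneg intro!: mult_nonneg_nonneg)
        define X where "X = \<phi> z powr r"
        have "\<bar>F z - \<psi> z\<bar> \<le> M * A * X"
        proof -
          have X: "X \<ge> 0" by (simp add: X_def)
          note bd' = bd[OF a z0, of s, folded \<phi>_def, folded X_def]
          have "F z - \<psi> z = - (a * ?T g2 std_bump z) - a * s ^ (2 * \<delta>) * ?T g2 (L \<delta>) z
              + s ^ (2 * \<theta>) * ?T time_profile (L \<theta>) z + s ^ (2 * \<alpha>) / a * ?T std_bump (L \<alpha>) z"
            unfolding F_def \<psi>_def tensor_scale by simp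
          also have "\<bar>\<dots>\<bar> \<le> a * (M1 * X) + a * s ^ (2 * \<delta>) * (M2 * X)
              + s ^ (2 * \<theta>) * (M3 * X) + s ^ (2 * \<alpha>) / a * (M4 * X)"
            using a s by (intro abs_combination_le bd') auto
          \<comment> \<open>As \<open>s \<le> 1\<close>, the term with \<open>\<delta>\<close> is no
            larger in order than the one from \<open>u_tt\<close>; hence \<open>\<delta>\<close>
            does not occur in the final bound.\<close>
          also have "\<dots> \<le> a * (M1 * X) + a * (M2 * X) + s ^ (2 * \<theta>) * (M3 * X) + s ^ (2 * \<alpha>) / a * (M4 * X)"
          proof -
            have "a * s ^ (2 * \<delta>) \<le> a" using a s by (simp add: mult_le_cancel_left1 power_le_one)
            then have "a * s ^ (2 * \<delta>) * (M2 * X) \<le> a * (M2 * X)" using M X by (intro mult_right_mono) auto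
            then show ?thesis by simp
          qed
          also have "\<dots> \<le> a * (M * X) + s ^ (2 * \<theta>) * (M * X) + s ^ (2 * \<alpha>) / a * (M * X)"
          proof -
            have "M1 * X + M2 * X \<le> M * X" "M3 * X \<le> M * X" "M4 * X \<le> M * X"
              using M X by (auto simp: M_def simp flip: distrib_right intro!: mult_right_mono)
            then have "a * (M1 * X + M2 * X) \<le> a * (M * X)"
              "s ^ (2 * \<theta>) * (M3 * X) \<le> s ^ (2 * \<theta>) * (M * X)"
              "s ^ (2 * \<alpha>) / a * (M4 * X) \<le> s ^ (2 * \<alpha>) / a * (M * X)"
              using a s by (auto intro!: mult_left_mono divide_right_mono)
            then show ?thesis by (simp add: distrib_left)
          qed
          also have "\<dots> = M * A * X" by (simp add: A_def algebra_simps)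
          finally show ?thesis .
        qed
        then have "\<bar>v z\<bar> * \<bar>F z - \<psi> z\<bar> \<le> \<bar>v z\<bar> * (M * A * X)" by (intro mult_left_mono) auto
        then have "v z * (F z - \<psi> z) \<le> M * A * (\<bar>v z\<bar> * X)"
          by (simp add: mult_ac abs_le_iff flip: abs_mult)
        \<comment> \<open>Young's inequality with \<open>b = M * A\<close>; its first summand
          cancels the nonlinear term.\<close>
        also have "\<dots> \<le> (\<bar>v z\<bar> * X) powr p + (M * A) powr (p / (p - 1))"
          using \<open>p > 1\<close> M a s by (intro young_scaled) (auto simp: X_def M_def A_def)
        also have "(\<bar>v z\<bar> * X) powr p = \<bar>v z\<bar> powr p * \<phi> z"
          using \<open>p > 1\<close> \<phi>0 by (simp add: powr_mult X_def powr_powr r_def)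
        finally show ?thesis using True by (simp add: algebra_simps)
      qed
    qed
    also have "\<dots> = (M * A) powr (p / (p - 1)) * (1 / (2 * a) * (2 / s) ^ DIM('a))"
    proof -
      have "measure lebesgue P = measure lborel P" by (simp add: P_def)
      also have "\<dots> = 1 / (2 * a) * (2 / s) ^ DIM('a)"
        unfolding P_def content_Pair using a s by (simp add: content_cbox_if box_eq_empty)
      finally show ?thesis unfolding set_lebesgue_integral_def PH by (simp add: P_def)
    qed
    finally have "?D \<le> (M * A) powr (p / (p - 1)) * (1 / (2 * a) * (2 / s) ^ DIM('a)) / time_profile (1 / 2)"
      unfolding pos_le_divide_eq[OF time_profile_half_pos] mult.commute[of ?D] .
    also have "\<dots> = (C / 2) * A powr (p / (p - 1)) / (a * s ^ DIM('a))"
      using M a s by (simp add: C_def A_def powr_mult M_def power_divide mult_ac)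
    also have "\<dots> \<le> C * A powr (p / (p - 1)) / (a * s ^ DIM('a))"
      using C0 a s by (intro divide_right_mono mult_right_mono) auto
    finally show ?thesis unfolding A_def .
  qed
  then show ?thesis using C0 by blast
qed

text \<open>Take \<open>s = 1 / R\<close> and \<open>a = R powr (- \<kappa>)\<close>. From
  \<open>\<kappa> \<le> 2 * \<theta>\<close> follows \<open>s ^ (2 * \<theta>) \<le> a\<close>, and
  from \<open>\<kappa> \<le> \<alpha>\<close> follows \<open>s ^ (2 * \<alpha>) / a \<le> a\<close>,
  so the sum in the previous bound is at most \<open>3 * a\<close>.\<close>

lemma weak_solution_data_growth:
  fixes u1 w :: "'a::euclidean_space \<Rightarrow> real"
  assumes sol: "global_weak_solution \<delta> \<theta> \<alpha> p u1 w u" and "p > 1"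
  defines "\<kappa> \<equiv> real (min (2 * \<theta>) \<alpha>)"
  shows "\<exists>C\<ge>0. \<forall>R\<ge>1. (LINT x|lebesgue. (u1 x + w x) * std_bump ((1 / R) *\<^sub>R x))
      \<le> C * R powr (real DIM('a) - \<kappa> / (p - 1))"
proof -
  define q where "q = p / (p - 1)"
  have q: "q > 0" using \<open>p > 1\<close> by (simp add: q_def)
  obtain C where C: "C \<ge> 0" and bd: "\<And>a s. 0 < a \<Longrightarrow> 0 < s \<Longrightarrow> s \<le> 1 \<Longrightarrow>
    (LINT x|lebesgue. (u1 x + w x) * std_bump (s *\<^sub>R x))
      \<le> C * (a + s ^ (2 * \<theta>) + s ^ (2 * \<alpha>) / a) powr q / (a * s ^ DIM('a))"
    using weak_solution_data_bound[OF sol \<open>p > 1\<close>] unfolding q_def by blast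
  have "(LINT x|lebesgue. (u1 x + w x) * std_bump ((1 / R) *\<^sub>R x))
      \<le> (C * 3 powr q) * R powr (real DIM('a) - \<kappa> / (p - 1))" if R: "R \<ge> 1" for R
  proof -
    define a where "a = R powr (- \<kappa>)"
    have a: "a > 0" using R by (simp add: a_def)
    have pw: "(1 / R) ^ k = R powr (- real k)" for k
      using R by (simp add: powr_minus powr_realpow power_one_over field_simps)
    have "(1 / R) ^ (2 * \<theta>) \<le> a"
      unfolding pw a_def using R by (intro powr_mono) (auto simp: \<kappa>_def)
    moreover have "(1 / R) ^ (2 * \<alpha>) / a \<le> a"
      unfolding pw a_def powr_diff[symmetric] using R by (intro powr_mono) (auto simp: \<kappa>_def min_def)
    ultimately have "(a + (1 / R) ^ (2 * \<theta>) + (1 / R) ^ (2 * \<alpha>) / a) powr q \<le> (3 * a) powr q"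
      using a R q by (intro powr_mono2) auto
    then have "(LINT x|lebesgue. (u1 x + w x) * std_bump ((1 / R) *\<^sub>R x))
        \<le> C * (3 * a) powr q / (a * (1 / R) ^ DIM('a))"
      using C a R by (intro order_trans[OF bd[of a "1 / R"]] divide_right_mono mult_left_mono) auto
    also have "\<dots> = (C * 3 powr q) * (a powr q / (a * (1 / R) ^ DIM('a)))"
      using a by (simp add: powr_mult)
    also have "a powr q / (a * (1 / R) ^ DIM('a)) = R powr (- \<kappa> * q - (- \<kappa> + - real DIM('a)))"
      unfolding pw a_def powr_diff powr_add powr_powr ..
    \<comment> \<open>Here \<open>q - 1 = 1 / (p - 1)\<close>.\<close>
    also have "- \<kappa> * q - (- \<kappa> + - real DIM('a)) = real DIM('a) - \<kappa> / (p - 1)"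
      using \<open>p > 1\<close> by (simp add: q_def field_simps)
    finally show ?thesis .
  qed
  then show ?thesis using C by (intro exI[of _ "C * 3 powr q"]) auto
qed

section \<open>Preparations for the limit of large \<open>R\<close>\<close>

lemma expinv_0_mono: "s \<le> t \<Longrightarrow> expinv 0 s \<le> expinv 0 t"
  by (auto simp: expinv_def frac_le)

lemma L1_loc_mult_std_bump_integrable:
  fixes f :: "'a::euclidean_space \<Rightarrow> real"
  assumes "L1_loc UNIV f" "R > 0"
  shows "integrable lebesgue (\<lambda>x. f x * std_bump ((1 / R) *\<^sub>R x))"
proof -
  have "set_integrable lebesgue UNIV (\<lambda>x. f x * std_bump ((1 / R) *\<^sub>R x))"
  proof (rule L1_loc_mult_integrable[OF assms(1) closed_UNIV])
    show "continuous_on UNIV (\<lambda>x::'a. std_bump ((1 / R) *\<^sub>R x))"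
      by (rule continuous_on_compose2[OF bumps_continuous[OF std_bump_bumps]])
         (auto intro!: continuous_intros)
    show "compact (cball (0::'a) R)" by simp
    show "std_bump ((1 / R) *\<^sub>R x) = 0" if "x \<notin> cball 0 R" for x :: 'a
      using that \<open>R > 0\<close> by (intro bumps_eq_0[OF std_bump_bumps]) auto
  qed
  then show ?thesis by (simp add: set_integrable_def)
qed

text \<open>Without subtraction the inequality can be passed to a limit in which one of the two
  parts becomes infinite.\<close>

lemma nn_integral_le_of_integral_le:
  assumes "integrable M g" "(LINT x|M. g x) \<le> B" "B \<ge> 0"
  shows "(\<integral>\<^sup>+x. ennreal (g x) \<partial>M) \<le> (\<integral>\<^sup>+x. ennreal (- g x) \<partial>M) + ennreal B"
proof -
  obtain r q where rq: "0 \<le> r" "0 \<le> q" "(\<integral>\<^sup>+x. ennreal (g x) \<partial>M) = ennreal r"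
      "(\<integral>\<^sup>+x. ennreal (- g x) \<partial>M) = ennreal q" "(LINT x|M. g x) = r - q"
    using integrableE[OF assms(1)] by metis
  then have "ennreal r \<le> ennreal (q + B)" using assms by (intro ennreal_leI) auto
  then show ?thesis using rq assms(3) by (simp add: ennreal_plus)
qed

section \<open>Nonexistence\<close>

text \<open>The range of \<open>p\<close> makes the growth exponent negative, so the bound on the
  data tends to 0. The cutoffs increase to a constant \<open>e\<close>: monotone convergence gives
  the limit of the positive part, while the negative part is estimated by its full integral. The
  result \<open>P * e \<le> N * e\<close> contradicts a positive integral.\<close>

lemma no_solution_of_pos_integral:
  fixes u1 w :: "'a::euclidean_space \<Rightarrow> real"
  assumes u1: "L1_loc UNIV u1" and w: "L1_loc UNIV w"
    and ex: "integral_exists (\<lambda>x. u1 x + w x)" and pos: "ext_integral (\<lambda>x. u1 x + w x) > 0"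
    and p: "1 < p" "p < 1 + real (min (2 * \<theta>) \<alpha>) / real DIM('a)"
  shows "\<not> global_weak_solution \<delta> \<theta> \<alpha> p u1 w u"
proof
  assume sol: "global_weak_solution \<delta> \<theta> \<alpha> p u1 w u"
  define f where "f = (\<lambda>x. u1 x + w x)"
  define \<kappa> where "\<kappa> = real (min (2 * \<theta>) \<alpha>)"
  define \<beta> where "\<beta> = real DIM('a) - \<kappa> / (p - 1)"
  have \<beta>: "\<beta> < 0"
    using p by (simp add: \<beta>_def \<kappa>_def field_simps)
  obtain C where C: "C \<ge> 0" "\<And>R. R \<ge> 1 \<Longrightarrow> (LINT x|lebesgue. f x * std_bump ((1 / R) *\<^sub>R x)) \<le> C * R powr \<beta>"
    using weak_solution_data_growth[OF sol p(1)] unfolding f_def \<beta>_def \<kappa>_def by blast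
  define P where "P = (\<integral>\<^sup>+x. ennreal (f x) \<partial>lebesgue)"
  define N where "N = (\<integral>\<^sup>+x. ennreal (- f x) \<partial>lebesgue)"
  have meas: "f \<in> borel_measurable lebesgue" and fin: "P < \<infinity> \<or> N < \<infinity>"
    using ex by (auto simp: integral_exists_def f_def P_def N_def)
  have "enn2ereal P - enn2ereal N > 0"
    using pos by (simp add: ext_integral_def f_def P_def N_def)
  \<comment> \<open>\<open>fin\<close> excludes the difference of two infinite values.\<close>
  with fin have NP: "N < P"
    by (cases P; cases N) (auto simp: ennreal_less_iff enn2ereal_ennreal)
  \<comment> \<open>The value of \<open>std_bump\<close> at the origin, which is its
    maximum.\<close>
  define e where "e = exp (- 1 :: real)"
  have bump_le: "std_bump (x :: 'a) \<le> e" for x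
    using expinv_0_mono[of "1 - (norm x)\<^sup>2" 1] by (simp add: std_bump_def expinv_def e_def)
  \<comment> \<open>The radii are \<open>Suc k\<close>, so that the growth bound, which needs
    \<open>R \<ge> 1\<close>, applies to every \<open>k\<close>.\<close>
  define b where "b = (\<lambda>(k::nat) x :: 'a. std_bump ((1 / real (Suc k)) *\<^sub>R x))"
  have b_meas: "b k \<in> borel_measurable lebesgue" for k
  proof -
    have "continuous_on UNIV (b k)" unfolding b_def
      by (rule continuous_on_compose2[OF bumps_continuous[OF std_bump_bumps]])
         (auto intro!: continuous_intros)
    then have "b k \<in> borel_measurable borel" by (rule borel_measurable_continuous_onI)
    then show ?thesis by (simp add: measurable_completion)
  qed
  have b_nn: "0 \<le> b k x" for k x by (simp add: b_def std_bump_nonneg)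
  have b_mono: "b k x \<le> b l x" if "k \<le> l" for k l x
  proof -
    have "norm ((1 / real (Suc l)) *\<^sub>R x) \<le> norm ((1 / real (Suc k)) *\<^sub>R x)"
      using that by (simp add: divide_left_mono)
    then show ?thesis unfolding b_def std_bump_def
      by (intro expinv_0_mono diff_left_mono power_mono) auto
  qed
  have b_lim: "(\<lambda>k. b k x) \<longlonglongrightarrow> e" for x
  proof -
    have "isCont std_bump (0::'a)"
      using bumps_continuous[OF std_bump_bumps] continuous_on_eq_continuous_at by blast
    moreover have "(\<lambda>k. (1 / real (Suc k)) *\<^sub>R x) \<longlonglongrightarrow> 0 *\<^sub>R x"
      using LIMSEQ_inverse_real_of_nat by (intro tendsto_intros) (simp add: inverse_eq_divide)
    ultimately have "(\<lambda>k. b k x) \<longlonglongrightarrow> std_bump (0::'a)"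
      unfolding b_def using isCont_tendsto_compose by fastforce
    then show ?thesis by (simp add: std_bump_def expinv_def e_def)
  qed
  have "(\<lambda>k. \<integral>\<^sup>+x. ennreal (f x) * ennreal (b k x) \<partial>lebesgue) \<longlonglongrightarrow> (\<integral>\<^sup>+x. ennreal (f x) * ennreal e \<partial>lebesgue)"
  proof (rule nn_integral_LIMSEQ)
    show "incseq (\<lambda>k x. ennreal (f x) * ennreal (b k x))"
      by (auto simp: incseq_def le_fun_def intro!: mult_left_mono ennreal_leI b_mono)
    show "(\<lambda>x. ennreal (f x) * ennreal (b k x)) \<in> borel_measurable lebesgue" for k
      using meas b_meas by measurable
    show "(\<lambda>k. ennreal (f x) * ennreal (b k x)) \<longlonglongrightarrow> ennreal (f x) * ennreal e" for x
      using b_lim by (intro ennreal_tendsto_cmult tendsto_ennrealI) auto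
  qed
  moreover have "(\<integral>\<^sup>+x. ennreal (f x) * ennreal e \<partial>lebesgue) = P * ennreal e"
    unfolding P_def using meas by (intro nn_integral_multc) measurable
  ultimately have lim: "(\<lambda>k. \<integral>\<^sup>+x. ennreal (f x) * ennreal (b k x) \<partial>lebesgue) \<longlonglongrightarrow> P * ennreal e"
    by simp
  have bound: "(\<integral>\<^sup>+x. ennreal (f x) * ennreal (b k x) \<partial>lebesgue)
      \<le> N * ennreal e + ennreal (C * real (Suc k) powr \<beta>)" for k
  proof -
    have "integrable lebesgue (\<lambda>x. u1 x * b k x + w x * b k x)"
      unfolding b_def by (intro Bochner_Integration.integrable_add L1_loc_mult_std_bump_integrable u1 w) auto
    then have i: "integrable lebesgue (\<lambda>x. f x * b k x)" by (simp add: f_def distrib_right)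
    have "(\<integral>\<^sup>+x. ennreal (f x) * ennreal (b k x) \<partial>lebesgue) = (\<integral>\<^sup>+x. ennreal (f x * b k x) \<partial>lebesgue)"
      using b_nn by (simp add: ennreal_mult'')
    also have "\<dots> \<le> (\<integral>\<^sup>+x. ennreal (- (f x * b k x)) \<partial>lebesgue) + ennreal (C * real (Suc k) powr \<beta>)"
      using i C by (intro nn_integral_le_of_integral_le) (auto simp: b_def)
    also have "(\<integral>\<^sup>+x. ennreal (- (f x * b k x)) \<partial>lebesgue) = (\<integral>\<^sup>+x. ennreal (- f x) * ennreal (b k x) \<partial>lebesgue)"
      using b_nn by (simp flip: ennreal_mult'')
    also have "\<dots> \<le> (\<integral>\<^sup>+x. ennreal (- f x) * ennreal e \<partial>lebesgue)"
      by (intro nn_integral_mono mult_left_mono ennreal_leI) (auto simp: b_def bump_le)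
    also have "\<dots> = N * ennreal e"
      unfolding N_def using meas by (intro nn_integral_multc) measurable
    finally show ?thesis by (simp add: add_right_mono)
  qed
  have "(\<lambda>k. C * real (Suc k) powr \<beta>) \<longlonglongrightarrow> 0"
    using \<beta> by real_asymp
  then have "(\<lambda>k. N * ennreal e + ennreal (C * real (Suc k) powr \<beta>)) \<longlonglongrightarrow> N * ennreal e + ennreal 0"
    by (intro tendsto_add tendsto_const tendsto_ennrealI)
  then have "P * ennreal e \<le> N * ennreal e"
    using LIMSEQ_le[OF lim] bound by auto
  moreover have "N * ennreal e < P * ennreal e"
    using NP by (intro ennreal_mult_strict_right_mono) (auto simp: e_def)
  ultimately show False by simp
qed

text \<open>On the ball of radius \<open>R / 2\<close> both the cutoff and the data have explicit
  lower bounds; elsewhere nonnegativity is enough. The data integral is thus at least of order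
  \<open>R powr (n - \<beta>) / log R\<close>, whereas a solution allows only
  \<open>R powr (n - \<mu>)\<close>. The range of \<open>p\<close> means exactly
  \<open>\<beta> < \<mu>\<close>.\<close>

lemma no_solution_of_slow_decay:
  fixes u1 w :: "'a::euclidean_space \<Rightarrow> real"
  assumes u1: "L1_loc UNIV u1" and w: "L1_loc UNIV w" and "\<epsilon> > 0" "m > 0"
    and lower: "AE x in lebesgue. u1 x + w x \<ge> \<epsilon> * (1 + norm x) powr (- (real DIM('a) / m))
             * inverse (ln (sqrt (1 + (norm x)\<^sup>2)))"
    and p: "1 < p" "p < 1 + real (min (2 * \<theta>) \<alpha>) / real DIM('a) * m"
  shows "\<not> global_weak_solution \<delta> \<theta> \<alpha> p u1 w u"
proof
  assume sol: "global_weak_solution \<delta> \<theta> \<alpha> p u1 w u"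
  define \<kappa> where "\<kappa> = real (min (2 * \<theta>) \<alpha>)"
  define \<mu> where "\<mu> = \<kappa> / (p - 1)"
  define \<beta> where "\<beta> = real DIM('a) / m"
  define l where "l = (\<lambda>R::real. ln (sqrt (1 + R\<^sup>2)))"
  have \<beta>: "\<beta> < \<mu>" "\<beta> > 0"
    using p \<open>m > 0\<close> by (auto simp: \<beta>_def \<mu>_def \<kappa>_def field_simps)
  obtain C where C: "C \<ge> 0" "\<And>R. R \<ge> 1 \<Longrightarrow> (LINT x|lebesgue. (u1 x + w x) * std_bump ((1 / R) *\<^sub>R x))
      \<le> C * R powr (real DIM('a) - \<mu>)"
    using weak_solution_data_growth[OF sol p(1)] unfolding \<mu>_def \<kappa>_def by blast
  \<comment> \<open>\<open>exp (- (4 / 3))\<close> is the value of \<open>std_bump\<close> at radius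
    \<open>1 / 2\<close>; the remaining geometric factors give the volume of the ball of radius
    \<open>R / 2\<close>, up to \<open>R ^ DIM('a)\<close>.\<close>
  define c where "c = \<epsilon> * exp (- (4 / 3)) * unit_ball_vol (real DIM('a)) / 2 ^ DIM('a)"
  have c: "c > 0" using \<open>\<epsilon> > 0\<close> by (simp add: c_def)
  have l_pos: "l r > 0" if "r > 0" for r using that unfolding l_def by (intro ln_gt_zero) simp
  have l_mono: "l r \<le> l R" if "0 \<le> r" "r \<le> R" for r R
    using that unfolding l_def by (subst ln_le_cancel_iff) (auto intro: power_mono add_pos_nonneg)
  have "c * ((1 + R) powr (- \<beta>) / l R) * R powr \<mu> \<le> C" if R: "R \<ge> 1" for R
  proof -
    define k where "k = \<epsilon> * (1 + R) powr (- \<beta>) / l R * exp (- (4 / 3))"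
    have lR: "l R > 0" using l_pos R by simp
    have "c * ((1 + R) powr (- \<beta>) / l R) * R ^ DIM('a) = k * measure lborel (cball (0::'a) (R / 2))"
      using R by (simp add: c_def k_def content_cball power_divide field_simps)
    also have "\<dots> = (LINT x|lebesgue. k * indicator (cball (0::'a) (R / 2)) x)"
      by simp
    also have "\<dots> \<le> (LINT x|lebesgue. (u1 x + w x) * std_bump ((1 / R) *\<^sub>R x))"
    proof (rule integral_mono_AE)
      show "integrable lebesgue (\<lambda>x. k * indicator (cball (0::'a) (R / 2)) x)"
        using lmeasurable_cball[of "0::'a" "R / 2"]
        by (intro integrable_mult_right integrable_real_indicator) (auto simp: fmeasurable_def)
      have "integrable lebesgue (\<lambda>x. u1 x * std_bump ((1 / R) *\<^sub>R x) + w x * std_bump ((1 / R) *\<^sub>R x))"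
        using R by (intro Bochner_Integration.integrable_add L1_loc_mult_std_bump_integrable u1 w) auto
      then show "integrable lebesgue (\<lambda>x. (u1 x + w x) * std_bump ((1 / R) *\<^sub>R x))"
        by (simp add: distrib_right)
      \<comment> \<open>At the origin the logarithm is 0 and its \<open>inverse\<close> is 0 by
        convention, so the comparison by monotonicity would fail there.\<close>
      have "AE x in lebesgue. x \<noteq> (0::'a)"
        by (rule AE_I[of _ _ "{0}"]) auto
      with lower show "AE x in lebesgue. k * indicator (cball (0::'a) (R / 2)) x
          \<le> (u1 x + w x) * std_bump ((1 / R) *\<^sub>R x)"
      proof eventually_elim
        case (elim x)
        have lx: "l (norm x) > 0" using l_pos elim by simp
        define h where "h = \<epsilon> * (1 + norm x) powr (- \<beta>) / l (norm x)"
        have h: "h \<le> u1 x + w x" "0 \<le> h"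
          using elim \<open>\<epsilon> > 0\<close> lx by (auto simp: h_def \<beta>_def l_def field_simps)
        show ?case
        proof (cases "x \<in> cball 0 (R / 2)")
          case True
          then have xR: "norm x \<le> R / 2" by simp
          have "\<epsilon> * (1 + R) powr (- \<beta>) / l R \<le> h"
            unfolding h_def using \<open>\<epsilon> > 0\<close> lx xR R \<beta> l_mono[of "norm x" R]
            by (intro frac_le mult_left_mono powr_mono2') (auto intro: add_pos_nonneg)
          moreover have "exp (- (4 / 3)) \<le> std_bump ((1 / R) *\<^sub>R x)"
          proof -
            have "norm ((1 / R) *\<^sub>R x) \<le> 1 / 2" using xR R by (simp add: field_simps)
            then have "(norm ((1 / R) *\<^sub>R x))\<^sup>2 \<le> (1 / 2)\<^sup>2" by (intro power_mono) auto
            then have "3 / 4 \<le> 1 - (norm ((1 / R) *\<^sub>R x))\<^sup>2" by (simp add: power2_eq_square)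
            from expinv_0_mono[OF this] show ?thesis by (simp add: std_bump_def expinv_def)
          qed
          ultimately have "k \<le> h * std_bump ((1 / R) *\<^sub>R x)"
            unfolding k_def using h by (intro mult_mono) auto
          also have "\<dots> \<le> (u1 x + w x) * std_bump ((1 / R) *\<^sub>R x)"
            using h std_bump_nonneg by (intro mult_right_mono) auto
          finally show ?thesis using True by simp
        next
          case False
          then show ?thesis using h std_bump_nonneg[of "(1 / R) *\<^sub>R x"] by simp
        qed
      qed
    qed
    also have "\<dots> \<le> C * R powr (real DIM('a) - \<mu>)" using C R by blast
    also have "\<dots> = C * R ^ DIM('a) / R powr \<mu>" using R by (simp add: powr_diff powr_realpow)
    finally have "c * ((1 + R) powr (- \<beta>) / l R) * R powr \<mu> * R ^ DIM('a) \<le> C * R ^ DIM('a)"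
      using R by (simp add: field_simps)
    then show ?thesis by (rule mult_right_le_imp_le) (use R in simp)
  qed
  \<comment> \<open>The positive power \<open>\<mu> - \<beta>\<close> of \<open>R\<close> beats the
    logarithm.\<close>
  moreover have "filterlim (\<lambda>R. c * ((1 + R) powr (- \<beta>) / l R) * R powr \<mu>) at_top at_top"
    unfolding l_def using c \<beta> by real_asymp
  then have "eventually (\<lambda>R. c * ((1 + R) powr (- \<beta>) / l R) * R powr \<mu> > C) at_top"
    by (simp add: filterlim_at_top_dense)
  then have "eventually (\<lambda>R. R \<ge> 1 \<and> c * ((1 + R) powr (- \<beta>) / l R) * R powr \<mu> > C) at_top"
    using eventually_ge_at_top[of "1::real"] by eventually_elim simp
  then obtain R where "R \<ge> 1" "c * ((1 + R) powr (- \<beta>) / l R) * R powr \<mu> > C"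
    by (auto simp: eventually_at_top_linorder)
  ultimately show False by fastforce
qed

text \<open>The two halves are the two preceding lemmas, read in a space of dimension
  \<open>CARD('n)\<close>.\<close>

theorem theorem2p1:
  fixes u1 w :: "real ^ 'n \<Rightarrow> real" and \<delta> \<theta> \<alpha> :: nat
  assumes "\<alpha> \<noteq> 0"
    and "L1_loc UNIV u1"
    and "L1_loc UNIV w"
    and "has_distr_neg_laplacian_pow \<delta> u1 w"
  shows
    "(\<forall>\<epsilon> m :: real.
        0 < \<epsilon> \<and> \<epsilon> < 1 \<and> 1 < m \<and> m \<le> 2 \<and>
        (AE x in lebesgue. u1 x + w x \<ge>
           \<epsilon> * (1 + norm x) powr (- (real CARD('n) / m))
             * inverse (ln (sqrt (1 + (norm x)\<^sup>2)))) \<longrightarrow>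
        (\<forall>p :: real. 1 < p \<and> p < 1 + real (min (2 * \<theta>) \<alpha>) / real CARD('n) * m \<longrightarrow>
           \<not> (\<exists>u :: real \<times> (real ^ 'n) \<Rightarrow> real. global_weak_solution \<delta> \<theta> \<alpha> p u1 w u)))
     \<and>
     (integral_exists (\<lambda>x. u1 x + w x) \<and> ext_integral (\<lambda>x. u1 x + w x) > 0 \<longrightarrow>
        (\<forall>p :: real. 1 < p \<and> p < 1 + real (min (2 * \<theta>) \<alpha>) / real CARD('n) \<longrightarrow>
           \<not> (\<exists>u :: real \<times> (real ^ 'n) \<Rightarrow> real. global_weak_solution \<delta> \<theta> \<alpha> p u1 w u)))"
proof (intro conjI allI impI notI)
  fix \<epsilon> m p :: real
  assume "0 < \<epsilon> \<and> \<epsilon> < 1 \<and> 1 < m \<and> m \<le> 2 \<and>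
        (AE x in lebesgue. u1 x + w x \<ge>
           \<epsilon> * (1 + norm x) powr (- (real CARD('n) / m))
             * inverse (ln (sqrt (1 + (norm x)\<^sup>2))))"
    and "1 < p \<and> p < 1 + real (min (2 * \<theta>) \<alpha>) / real CARD('n) * m"
    and "\<exists>u :: real \<times> (real ^ 'n) \<Rightarrow> real. global_weak_solution \<delta> \<theta> \<alpha> p u1 w u"
  then show False
    using no_solution_of_slow_decay[OF assms(2,3), of \<epsilon> m p \<theta> \<alpha>] by auto
next
  fix p :: real
  assume "integral_exists (\<lambda>x. u1 x + w x) \<and> ext_integral (\<lambda>x. u1 x + w x) > 0"
    and "1 < p \<and> p < 1 + real (min (2 * \<theta>) \<alpha>) / real CARD('n)"
    and "\<exists>u :: real \<times> (real ^ 'n) \<Rightarrow> real. global_weak_solution \<delta> \<theta> \<alpha> p u1 w u"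
  then show False
    using no_solution_of_pos_integral[OF assms(2,3), of p \<theta> \<alpha>] by auto
qed

end
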